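(* Let $\epsilon>0$, let $a$ be a positive integer, and let $G$ be a finite abelian group whose exponent divides $a$. There exist constants $K,c>0$, depending only on $a$, $\epsilon$ and $G$, such that for every $n$ and every $\epsilon$-balanced random digraph $\Gamma(n)$ on $[n]$, \[\Big|\mathbb{E}\big(\#\mathrm{Sur}(S(\Gamma(n)),G)\big)-\frac{1}{|G|}\Big|\le K e^{-cn}.\]
   Context: Digraphs may have multiple edges (and loops). $\deg(i,j)$ is the number of edges from $i$ to $j$, and $\mathrm{outdeg}(i)$ is the number of edges leaving $i$. A random variable $y$ in a ring $T$ is $\epsilon$-balanced if for every maximal ideal $\mathfrak p$ of $T$ and every $r\in T/\mathfrak p$, $\mathbb{P}(y\equiv r\bmod\mathfrak p)\le1-\epsilon$. A random digraph on $[n]$ is $\epsilon$-balanced if the $\deg(i,j)$ for ordered pairs $i\ne j$ are independent $\epsilon$-balanced random variables in $\mathbb{Z}$. The Laplacian $L$ has entries $L_{ij}=-\deg(j,i)$ for $i\ne j$ and $L_{jj}=\mathrm{outdeg}(j)-\deg(j,j)$, so its columns sum to $0$. The total sandpile group is $S(\Gamma)=\mathbb{Z}^n_0/L\mathbb{Z}^n$, where $\mathbb{Z}^n_0$ is the subgroup of $\mathbb{Z}^n$ of vectors with entry sum $0$. $\mathrm{Sur}(A,B)$ denotes the set of surjective homomorphisms $A\to B$. *)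

theory Defs
  imports "HOL-Probability.Product_PMF" "HOL-Algebra.Coset" "HOL-Algebra.FiniteProduct"
begin

text \<open>Vertices are 0..<n. A (loopless part of a) multidigraph on [n] is given by its
  degree function deg :: nat \<times> nat \<Rightarrow> nat, deg (i,j) = number of edges from i to j, for i \<noteq> j.\<close>

definition offdiag :: "nat \<Rightarrow> (nat \<times> nat) set" where
  "offdiag n = {(i,j). i < n \<and> j < n \<and> i \<noteq> j}"

text \<open>Laplacian: L i j = - deg(j,i) for i \<noteq> j, L j j = outdeg j - deg(j,j) = sum over k \<noteq> j of deg(j,k).\<close>
definition laplacian :: "nat \<Rightarrow> (nat \<times> nat \<Rightarrow> nat) \<Rightarrow> nat \<Rightarrow> nat \<Rightarrow> int" where
  "laplacian n deg i j =
     (if i = j then (\<Sum>k\<in>{..<n} - {j}. int (deg (j,k))) else - int (deg (j,i)))"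

definition Zn0 :: "nat \<Rightarrow> (nat \<Rightarrow> int) monoid" where
  "Zn0 n = \<lparr>carrier = {v. (\<forall>i\<ge>n. v i = 0) \<and> (\<Sum>i<n. v i) = 0},
            mult = (\<lambda>u v i. u i + v i), one = (\<lambda>i. 0)\<rparr>"

definition lap_image :: "nat \<Rightarrow> (nat \<times> nat \<Rightarrow> nat) \<Rightarrow> (nat \<Rightarrow> int) set" where
  "lap_image n deg = {(\<lambda>i. if i < n then (\<Sum>j<n. laplacian n deg i j * x j) else 0) | x :: nat \<Rightarrow> int. True}"

definition sandpile :: "nat \<Rightarrow> (nat \<times> nat \<Rightarrow> nat) \<Rightarrow> (nat \<Rightarrow> int) set monoid" where
  "sandpile n deg = Zn0 n Mod lap_image n deg"

definition Sur :: "('a, 'c) monoid_scheme \<Rightarrow> ('b, 'd) monoid_scheme \<Rightarrow> ('a \<Rightarrow> 'b) set" where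
  "Sur A B = {h. h \<in> hom A B \<and> h ` carrier A = carrier B \<and> h \<in> extensional (carrier A)}"

definition balanced_rv :: "real \<Rightarrow> nat pmf \<Rightarrow> bool" where
  "balanced_rv eps Y \<longleftrightarrow>
     (\<forall>p::int. prime p \<longrightarrow> (\<forall>r::int. measure_pmf.prob Y {d. int d mod p = r mod p} \<le> 1 - eps))"

definition random_digraph :: "nat \<Rightarrow> (nat \<times> nat \<Rightarrow> nat pmf) \<Rightarrow> (nat \<times> nat \<Rightarrow> nat) pmf" where
  "random_digraph n D = Pi_pmf (offdiag n) 0 D"

definition balanced_digraph :: "real \<Rightarrow> nat \<Rightarrow> (nat \<times> nat \<Rightarrow> nat pmf) \<Rightarrow> bool" where
  "balanced_digraph eps n D \<longleftrightarrow> (\<forall>e\<in>offdiag n. balanced_rv eps (D e))"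

end

theory Submission
  imports Defs "HOL-Algebra.Generated_Groups"
begin

text \<open>
  A surjection from the sandpile group to \<open>G\<close> is a labelling \<open>f\<close> of the vertices by elements of \<open>G\<close> with
  \<open>f 0 = 1\<close>, generating \<open>G\<close>, such that for every vertex \<open>j\<close> the product over \<open>k\<close> of
  \<open>(f j / f k) ^ deg (j, k)\<close> is trivial. The rows of the degree matrix are independent, so the
  expected number of surjections is the sum over \<open>f\<close> of a product of row probabilities.

  If the values that \<open>f\<close> takes at least \<open>\<delta> n\<close> times have quotients generating \<open>G\<close>, every row
  product is exponentially close to uniform on \<open>G\<close>: each frequent quotient contributes many
  factors \<open>|E w ^ deg| \<le> \<rho> < 1\<close> to every nontrivial Fourier coefficient. Such \<open>f\<close> contribute
  \<open>1 / |G|\<close> up to an exponentially small error. Otherwise \<open>f\<close> lies in a coset \<open>y H\<close> of a proper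
  subgroup outside a small set of exceptional vertices. A row at a nonexceptional vertex is trivial
  with probability about \<open>(1 - \<epsilon>) / |H|\<close> at most, because a single exceptional vertex must cancel
  modulo \<open>H\<close>. The factor \<open>(1 - \<epsilon>)\<close> per vertex beats the number of such labellings.
\<close>

section \<open>Balanced random integers\<close>

text \<open>The limit is \<open>1 / |G|\<close> because fixing \<open>f 0 = 1\<close> leaves
  \<open>|G| ^ (n - 1)\<close> labellings against \<open>n\<close> rows, each typically trivial with
  probability near \<open>1 / |G|\<close>. To make this main term exact, every labelling with
  \<open>f 0 = 1\<close> is compared with \<open>(1 / |G|) ^ n\<close>, the nongenerating ones
  included. The obstacle is the labellings concentrated on a coset of a proper subgroup
  \<open>H\<close>: there are about \<open>|H| ^ n\<close> of them, with row probabilities about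
  \<open>1 / |H|\<close>, so counting alone gives no decay. Generation together with
  \<open>f 0 = 1\<close> forces at least one exceptional vertex, and the degree towards it must fall
  into one residue class modulo a prime, which costs every nonexceptional row a constant factor. The
  tolerated fraction \<alpha> of exceptional vertices has to be so small that the freedom in
  choosing them does not use up this gain. Degrees matter only modulo \<open>a\<close>, so all
  constants come from finitely many roots of unity, subgroups and words in \<open>G\<close>. Hence
  they depend neither on \<open>n\<close> nor on the degree distributions.\<close>

lemma proper_int_subgroup_prime_dvd:
  fixes I :: "int set"
  assumes diff: "\<And>x y. x \<in> I \<Longrightarrow> y \<in> I \<Longrightarrow> x - y \<in> I" and "1 \<notin> I"
  shows "\<exists>p. prime p \<and> (\<forall>x\<in>I. p dvd x)"
proof (cases "\<exists>x\<in>I. x \<noteq> 0")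
  case False
  then show ?thesis using two_is_prime by (intro exI[of _ 2]) auto
next
  case True
  then obtain x0 where x0: "x0 \<in> I" "x0 \<noteq> 0" by blast
  have zero: "0 \<in> I" using diff[OF x0(1) x0(1)] by simp
  have neg: "- x \<in> I" if "x \<in> I" for x using diff[OF zero that] by simp
  have add: "x + y \<in> I" if "x \<in> I" "y \<in> I" for x y using diff[OF that(1) neg[OF that(2)]] by simp
  have nmult: "int n * x \<in> I" if "x \<in> I" for n x
    by (induction n) (auto simp: zero algebra_simps intro: add that)
  have mult: "k * x \<in> I" if "x \<in> I" for k x
  proof (cases "k \<ge> 0")
    case True
    then show ?thesis using nmult[OF that, of "nat k"] by simp
  next
    case False
    then show ?thesis using neg[OF nmult[OF that, of "nat (- k)"]] by simp
  qed
  define m where "m = (LEAST m. m > 0 \<and> int m \<in> I)"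
  have "\<exists>m. m > 0 \<and> int m \<in> I"
  proof (cases "x0 > 0")
    case True then show ?thesis using x0 by (intro exI[of _ "nat x0"]) auto
  next
    case False then show ?thesis using x0 neg[OF x0(1)] by (intro exI[of _ "nat (- x0)"]) auto
  qed
  then have m: "m > 0" "int m \<in> I" unfolding m_def by (metis (mono_tags, lifting) LeastI_ex)+
  have least: "m \<le> k" if "k > 0" "int k \<in> I" for k unfolding m_def using that by (simp add: Least_le)
  have dvd: "int m dvd x" if "x \<in> I" for x
  proof (rule ccontr)
    assume "\<not> int m dvd x"
    then have pos: "x mod int m > 0" 
      using m by (metis dvd_eq_mod_eq_0 of_nat_0_less_iff order_le_imp_less_or_eq pos_mod_sign)
    have "x - (x div int m) * int m \<in> I" using that m(2) mult diff by blast
    then have "x mod int m \<in> I" by (simp add: minus_div_mult_eq_mod)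
    then have "m \<le> nat (x mod int m)" using pos by (intro least) auto
    moreover have "x mod int m < int m" using m by simp
    ultimately show False using pos by linarith
  qed
  have "m \<noteq> 1" using m(2) \<open>1 \<notin> I\<close> by auto
  then obtain q where "prime q" "q dvd m" using prime_factor_nat by blast
  then have "prime (int q)" "\<forall>x\<in>I. int q dvd x"
    using dvd by (auto intro: dvd_trans[of "int q" "int m"])
  then show ?thesis by blast
qed

lemma balanced_rv_mono: "balanced_rv eps Y \<Longrightarrow> e \<le> eps \<Longrightarrow> balanced_rv e Y"
  unfolding balanced_rv_def by (meson diff_left_mono order_trans)

text \<open>Balancedness speaks only of primes. A proper subgroup \<open>I\<close> of the integers
  lies in some \<open>p\<close> Z, so a set inside one coset of \<open>I\<close> lies in one residue
  class modulo \<open>p\<close>. In the applications \<open>I\<close> consists of the exponents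
  \<open>m\<close> with \<open>w ^ m = 1\<close>, or with \<open>g ^ m\<close> in a
  subgroup.\<close>

lemma balanced_rv_prob_coset_le:
  fixes I :: "int set"
  assumes bal: "balanced_rv eps Y"
    and I: "\<And>x y. x \<in> I \<Longrightarrow> y \<in> I \<Longrightarrow> x - y \<in> I" "1 \<notin> I"
    and X: "\<And>x y. x \<in> X \<Longrightarrow> y \<in> X \<Longrightarrow> int x - int y \<in> I"
  shows "measure_pmf.prob Y X \<le> 1 - eps"
proof -
  obtain p where p: "prime p" "\<forall>x\<in>I. p dvd x" using proper_int_subgroup_prime_dvd[OF I] by blast
  obtain r where "X \<subseteq> {d. int d mod p = r mod p}"
  proof (cases "X = {}")
    case False
    then obtain x where "x \<in> X" by blast
    then have "int d mod p = int x mod p" if "d \<in> X" for d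
      using X[OF that \<open>x \<in> X\<close>] p by (simp add: mod_eq_dvd_iff)
    then show ?thesis using that[of "int x"] by blast
  qed (use that in auto)
  then have "measure_pmf.prob Y X \<le> measure_pmf.prob Y {d. int d mod p = r mod p}"
    by (intro measure_pmf.finite_measure_mono) auto
  also have "\<dots> \<le> 1 - eps" using bal p unfolding balanced_rv_def by blast
  finally show ?thesis .
qed

text \<open>Powers in a group whose exponent divides \<open>a\<close> see a degree only modulo
  \<open>a\<close>. The reduction gives finite support, so expectations become sums over
  \<open>d < a\<close>.\<close>

definition residue_pmf :: "nat \<Rightarrow> nat pmf \<Rightarrow> nat pmf" where
  "residue_pmf a Y = map_pmf (\<lambda>m. m mod a) Y"

lemma set_residue_pmf: "a > 0 \<Longrightarrow> set_pmf (residue_pmf a Y) \<subseteq> {..<a}"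
  by (auto simp: residue_pmf_def)

lemma sum_residue_pmf: "a > 0 \<Longrightarrow> (\<Sum>d<a. pmf (residue_pmf a Y) d) = 1"
  by (intro sum_pmf_eq_1 set_residue_pmf) auto

text \<open>As \<open>a\<close> itself lies in \<open>I\<close>, reduction modulo \<open>a\<close>
  does not change cosets of \<open>I\<close>, and the bound for \<open>Y\<close> carries
  over.\<close>

lemma sum_residue_pmf_coset_le:
  fixes I :: "int set"
  assumes bal: "balanced_rv eps Y"
    and I: "\<And>x y. x \<in> I \<Longrightarrow> y \<in> I \<Longrightarrow> x - y \<in> I" "1 \<notin> I" "int a \<in> I"
    and X: "\<And>x y. x \<in> X \<Longrightarrow> y \<in> X \<Longrightarrow> int x - int y \<in> I" and "finite X"
  shows "(\<Sum>d\<in>X. pmf (residue_pmf a Y) d) \<le> 1 - eps"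
proof -
  have zero: "0 \<in> I" using I(1)[OF I(3) I(3)] by simp
  have neg: "- x \<in> I" if "x \<in> I" for x using I(1)[OF zero that] by simp
  have add: "x + y \<in> I" if "x \<in> I" "y \<in> I" for x y using I(1)[OF that(1) neg[OF that(2)]] by simp
  have nmult: "int n * int a \<in> I" for n
    by (induction n) (auto simp: zero algebra_simps intro: add I)
  have "(\<Sum>d\<in>X. pmf (residue_pmf a Y) d) = measure_pmf.prob (residue_pmf a Y) X"
    using \<open>finite X\<close> by (simp add: measure_measure_pmf_finite)
  also have "\<dots> = measure_pmf.prob Y ((\<lambda>m. m mod a) -` X)"
    by (simp add: residue_pmf_def measure_map_pmf)
  also have "\<dots> \<le> 1 - eps"
  proof (rule balanced_rv_prob_coset_le[OF bal I(1,2)])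
    fix x y assume "x \<in> (\<lambda>m. m mod a) -` X" "y \<in> (\<lambda>m. m mod a) -` X"
    then have 1: "int (x mod a) - int (y mod a) \<in> I" using X by auto
    have "int x - int y = (int (x mod a) - int (y mod a)) + (int (x div a) * int a - int (y div a) * int a)"
      by (metis (no_types, lifting) add_diff_add add.commute of_nat_add of_nat_mult div_mult_mod_eq)
    then show "int x - int y \<in> I" using 1 nmult I(1) add by metis
  qed
  finally show ?thesis .
qed

lemma Re_of_real_times: "Re (of_real x * z) = x * Re z"
  by simp

text \<open>Only finitely many roots differ from \<open>1\<close>, and each has norm
  \<open>1\<close> and hence real part below \<open>1\<close>. The gap depends on \<open>a\<close>
  alone, which makes the later contraction uniform in the distribution.\<close>

lemma root_unity_Re_gap:
  assumes "a > 0"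
  shows "\<exists>\<kappa><1. \<forall>u::complex. u ^ a = 1 \<longrightarrow> u \<noteq> 1 \<longrightarrow> Re u \<le> \<kappa>"
proof -
  let ?R = "{u::complex. u ^ a = 1 \<and> u \<noteq> 1}"
  have fin: "finite ?R" using finite_roots_unity[of a, where 'a = complex] assms
    by (auto intro: finite_subset[rotated])
  have less: "Re u < 1" if "u \<in> ?R" for u
  proof -
    have n: "cmod u = 1" using that assms power_eq_imp_eq_norm[of u a 1] by auto
    have "Re u \<noteq> 1"
    proof
      assume "Re u = 1"
      then have "Im u = 0" using n cmod_power2[of u] by simp
      then show False using that \<open>Re u = 1\<close> complex_eqI[of u 1] by auto
    qed
    then show ?thesis using complex_Re_le_cmod[of u] n by linarith
  qed
  \<comment> \<open>The extra \<open>0\<close> keeps the set nonempty when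
    \<open>a = 1\<close>.\<close>
  define \<kappa> where "\<kappa> = Max (insert 0 (Re ` ?R))"
  have "\<kappa> < 1" unfolding \<kappa>_def using fin less by (subst Max_less_iff) auto
  moreover have "Re u \<le> \<kappa>" if "u ^ a = 1" "u \<noteq> 1" for u
    unfolding \<kappa>_def using fin that by (intro Max_ge) auto
  ultimately show ?thesis by blast
qed

text \<open>The squared norm of \<open>E w ^ d\<close> is the expectation of
  \<open>Re (w ^ r * cnj (w ^ s))\<close> for two independent copies \<open>r\<close>,
  \<open>s\<close>. Given \<open>s\<close>, the \<open>r\<close> with \<open>w ^ r = w ^ s\<close>
  lie in a coset of the proper subgroup of exponents killing \<open>w\<close>. So with probability
  at least \<open>eps\<close> the term is at most \<kappa> instead of \<open>1\<close>.\<close>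

lemma balanced_character_contraction:
  assumes a: "a > 0" and e: "eps > 0"
  shows "\<exists>\<rho>::real. 0 < \<rho> \<and> \<rho> < 1 \<and> (\<forall>w Y. w ^ a = 1 \<longrightarrow> w \<noteq> 1 \<longrightarrow> balanced_rv eps Y \<longrightarrow>
           cmod (\<Sum>d<a. of_real (pmf (residue_pmf a Y) d) * w ^ d) \<le> \<rho>)"
proof -
  obtain \<kappa> where \<kappa>: "\<kappa> < 1" "\<And>u::complex. u ^ a = 1 \<Longrightarrow> u \<noteq> 1 \<Longrightarrow> Re u \<le> \<kappa>"
    using root_unity_Re_gap[OF a] by blast
  \<comment> \<open>The maximum with \<open>1/4\<close> keeps \<rho> positive, since the second
    entry may be negative for large \<open>eps\<close>.\<close>
  define \<rho> where "\<rho> = sqrt (max (1/4) (1 - (1 - \<kappa>) * eps))"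
  have \<rho>: "0 < \<rho>" "\<rho> < 1" using \<kappa>(1) e by (auto simp: \<rho>_def max_def)
  have "cmod (\<Sum>d<a. of_real (pmf (residue_pmf a Y) d) * w ^ d) \<le> \<rho>"
    if w: "w ^ a = 1" "w \<noteq> 1" and bal: "balanced_rv eps Y" for w Y
  proof -
    define c where "c = pmf (residue_pmf a Y)"
    have c0: "c d \<ge> 0" for d by (simp add: c_def)
    have c1: "(\<Sum>d<a. c d) = 1" unfolding c_def by (rule sum_residue_pmf[OF a])
    have norm_w: "cmod w = 1" using w a power_eq_imp_eq_norm[of w a 1] by auto
    have w0: "w \<noteq> 0" using norm_w by auto
    have cnjw: "w * cnj w = 1" using norm_w by (simp add: complex_norm_square[symmetric])
    define z where "z = (\<Sum>d<a. of_real (c d) * w ^ d)"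
    have Re_le: "Re (w ^ r * cnj (w ^ s)) \<le> 1 - (1 - \<kappa>) * of_bool (w ^ r \<noteq> w ^ s)" for r s
    proof (cases "w ^ r = w ^ s")
      case True
      then show ?thesis using complex_norm_square[of "w ^ s"] norm_w
        by (simp add: norm_power)
    next
      case False
      let ?u = "w ^ r * cnj (w ^ s)"
      have "?u ^ a = (w ^ a) ^ r * cnj ((w ^ a) ^ s)"
        by (simp add: power_mult_distrib power_mult[symmetric] mult.commute)
      then have 1: "?u ^ a = 1" using w by simp
      have "?u \<noteq> 1"
      proof
        assume "?u = 1"
        then have "?u * w ^ s = w ^ s" by simp
        moreover have "?u * w ^ s = w ^ r * (w * cnj w) ^ s"
          by (simp add: power_mult_distrib algebra_simps)
        ultimately show False using False cnjw by (metis mult.right_neutral power_one)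
      qed
      then show ?thesis using \<kappa>(2)[OF 1] False by simp
    qed
    have inner: "(\<Sum>r<a. c r * of_bool (w ^ r \<noteq> w ^ s)) \<ge> eps" for s
    proof -
      have "(\<Sum>r\<in>{r\<in>{..<a}. w ^ r = w ^ s}. c r) \<le> 1 - eps"
        unfolding c_def
      proof (rule sum_residue_pmf_coset_le[OF bal, of "{m. w powi m = 1}"])
        show "x - y \<in> {m. w powi m = 1}" if "x \<in> {m. w powi m = 1}" "y \<in> {m. w powi m = 1}" for x y
          using that w0 by (simp add: power_int_diff)
        show "1 \<notin> {m. w powi m = 1}" using w by simp
        show "int a \<in> {m. w powi m = 1}" using w by simp
        show "int x - int y \<in> {m. w powi m = 1}"
          if "x \<in> {r\<in>{..<a}. w ^ r = w ^ s}" "y \<in> {r\<in>{..<a}. w ^ r = w ^ s}" for x y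
          using that w0 by (simp add: power_int_diff)
      qed auto
      moreover have "(\<Sum>r<a. c r * of_bool (w ^ r \<noteq> w ^ s)) + (\<Sum>r\<in>{r\<in>{..<a}. w ^ r = w ^ s}. c r) = (\<Sum>r<a. c r)"
      proof -
        have "(\<Sum>r\<in>{r\<in>{..<a}. w ^ r = w ^ s}. c r) = (\<Sum>r<a. c r * of_bool (w ^ r = w ^ s))"
          by (rule sum.mono_neutral_cong_left) auto
        then show ?thesis by (simp only: sum.distrib[symmetric]) (rule sum.cong, auto)
      qed
      ultimately show ?thesis using c1 by linarith
    qed
    have factor: "(\<Sum>r<a. x * c r * (1 - k * b r)) = x * ((\<Sum>r<a. c r) - k * (\<Sum>r<a. c r * b r))"
      for x k and b :: "nat \<Rightarrow> real"
      by (simp add: sum_distrib_left algebra_simps sum_subtractf sum.distrib)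
    have "(cmod z)\<^sup>2 = Re (z * cnj z)" by (metis Re_complex_of_real complex_norm_square)
    also have "z * cnj z = (\<Sum>s<a. \<Sum>r<a. of_real (c s * c r) * (w ^ r * cnj (w ^ s)))"
    proof -
      have "z * cnj z = (\<Sum>r<a. \<Sum>s<a. (of_real (c r) * w ^ r) * cnj (of_real (c s) * w ^ s))"
        unfolding z_def cnj_sum sum_product ..
      also have "\<dots> = (\<Sum>s<a. \<Sum>r<a. (of_real (c r) * w ^ r) * cnj (of_real (c s) * w ^ s))"
        by (rule sum.swap)
      finally show ?thesis by (simp add: mult_ac)
    qed
    also have "Re \<dots> = (\<Sum>s<a. \<Sum>r<a. c s * c r * Re (w ^ r * cnj (w ^ s)))"
      unfolding Re_sum by (intro sum.cong refl) (rule Re_of_real_times)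
    also have "\<dots> \<le> (\<Sum>s<a. \<Sum>r<a. c s * c r * (1 - (1 - \<kappa>) * of_bool (w ^ r \<noteq> w ^ s)))"
      by (intro sum_mono mult_left_mono Re_le mult_nonneg_nonneg c0)
    also have "\<dots> = (\<Sum>s<a. c s * ((\<Sum>r<a. c r) - (1 - \<kappa>) * (\<Sum>r<a. c r * of_bool (w ^ r \<noteq> w ^ s))))"
      by (intro sum.cong refl) (rule factor)
    also have "\<dots> \<le> (\<Sum>s<a. c s * (1 - (1 - \<kappa>) * eps))"
      using inner \<kappa>(1) c1 by (intro sum_mono mult_left_mono c0) (simp add: mult_left_mono)
    also have "\<dots> = 1 - (1 - \<kappa>) * eps" using c1 by (simp add: sum_distrib_right[symmetric])
    finally have "cmod z \<le> \<rho>" unfolding \<rho>_def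
      by (intro real_le_rsqrt) (simp add: le_max_iff_disj)
    then show ?thesis unfolding z_def c_def .
  qed
  then show ?thesis using \<rho> by blast
qed

lemma sum_powers_roots_unity:
  assumes "0 < m" "m < a"
  shows "(\<Sum>w | w ^ a = 1. w ^ m) = (0::complex)"
proof -
  let ?f = "\<lambda>k. cis (2 * pi * real k / real a)"
  have bij: "bij_betw ?f {..<a} {z. z ^ a = 1}" using assms by (intro Complex.bij_betw_roots_unity) auto
  have ne: "?f m \<noteq> 1"
  proof
    assume "?f m = 1"
    then have "?f m = ?f 0" by simp
    then have "m = 0" using bij assms unfolding bij_betw_def inj_on_def by (metis lessThan_iff order.strict_trans)
    then show False using assms by simp
  qed
  have pow: "?f k ^ m = ?f m ^ k" for k by (simp add: Complex.DeMoivre algebra_simps)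
  have "?f m \<in> {z. z ^ a = 1}" using bij assms unfolding bij_betw_def by blast
  then have one: "?f m ^ a = 1" by simp
  have "(\<Sum>w | w ^ a = 1. w ^ m) = (\<Sum>k<a. ?f k ^ m)"
    by (rule sum.reindex_bij_betw[OF bij, symmetric])
  also have "\<dots> = (\<Sum>k<a. ?f m ^ k)" by (simp only: pow)
  also have "\<dots> = 0" using geometric_sum[OF ne, of a] one by simp
  finally show ?thesis .
qed

section \<open>Random products in a finite abelian group\<close>

locale finite_exponent_group = comm_group G for G (structure) +
  fixes a :: nat
  assumes finite_carrier: "finite (carrier G)"
    and exponent_pos: "a > 0"
    and pow_exponent: "x \<in> carrier G \<Longrightarrow> x [^] a = \<one>"
begin

lemma pow_mod_exponent:
  assumes "x \<in> carrier G"
  shows "x [^] (d mod a) = x [^] (d::nat)"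
proof -
  have "x [^] d = x [^] (d div a * a + d mod a)" by (simp only: div_mult_mod_eq)
  also have "\<dots> = (x [^] (a * (d div a))) \<otimes> x [^] (d mod a)"
    using assms nat_pow_mult[OF assms, of "a * (d div a)" "d mod a"] by (simp add: mult.commute)
  also have "x [^] (a * (d div a)) = \<one>"
    using assms by (simp add: nat_pow_pow[symmetric] pow_exponent)
  finally show ?thesis using assms by simp
qed

definition product_law :: "'k set \<Rightarrow> ('k \<Rightarrow> nat pmf) \<Rightarrow> ('k \<Rightarrow> 'a) \<Rightarrow> 'a pmf" where
  "product_law A p g = map_pmf (\<lambda>d. \<Otimes>k\<in>A. g k [^] d k) (Pi_pmf A 0 p)"

lemma set_product_law: "g \<in> A \<rightarrow> carrier G \<Longrightarrow> set_pmf (product_law A p g) \<subseteq> carrier G"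
  by (auto simp: product_law_def intro!: finprod_closed)

lemma sum_product_law: "g \<in> A \<rightarrow> carrier G \<Longrightarrow> (\<Sum>z\<in>carrier G. pmf (product_law A p g) z) = 1"
  by (intro sum_pmf_eq_1 finite_carrier set_product_law)

lemma pmf_translate:
  assumes "set_pmf M \<subseteq> carrier G" "x \<in> carrier G" "z \<in> carrier G"
  shows "pmf (map_pmf (\<lambda>y. x \<otimes> y) M) z = pmf M (inv x \<otimes> z)"
proof -
  have z: "z = x \<otimes> (inv x \<otimes> z)" using assms by (simp add: m_assoc[symmetric])
  have inj: "inj_on (\<lambda>y. x \<otimes> y) (set_pmf M)" using assms by (auto simp: inj_on_def subset_iff)
  show ?thesis
  proof (cases "inv x \<otimes> z \<in> set_pmf M")
    case True
    then show ?thesis using pmf_map_inj[OF inj True] z by simp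
  next
    case False
    have "z \<notin> set_pmf (map_pmf (\<lambda>y. x \<otimes> y) M)"
    proof
      assume "z \<in> set_pmf (map_pmf (\<lambda>y. x \<otimes> y) M)"
      then obtain y where "y \<in> set_pmf M" "z = x \<otimes> y" by auto
      then have "inv x \<otimes> z = y" using assms by (auto simp: m_assoc[symmetric] subset_iff)
      then show False using False \<open>y \<in> set_pmf M\<close> by simp
    qed
    then show ?thesis using False by (metis pmf_eq_0_set_pmf)
  qed
qed

lemma product_law_insert:
  assumes A: "finite A" "k \<notin> A" and g: "g \<in> insert k A \<rightarrow> carrier G"
  shows "product_law (insert k A) p g =
           bind_pmf (residue_pmf a (p k)) (\<lambda>d. map_pmf (\<lambda>y. g k [^] d \<otimes> y) (product_law A p g))"
proof -
  have gk: "g k \<in> carrier G" and gA: "\<And>i. i \<in> A \<Longrightarrow> g i \<in> carrier G" using g by auto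
  have upd: "(\<Otimes>i\<in>insert k A. g i [^] (h(k := d)) i) = g k [^] (d mod a) \<otimes> (\<Otimes>i\<in>A. g i [^] h i)"
    for d :: nat and h
  proof -
    have "(\<Otimes>i\<in>insert k A. g i [^] (h(k := d)) i) = g k [^] d \<otimes> (\<Otimes>i\<in>A. g i [^] (h(k := d)) i)"
      using A gk gA by (subst finprod_insert) (auto simp: Pi_def)
    also have "(\<Otimes>i\<in>A. g i [^] (h(k := d)) i) = (\<Otimes>i\<in>A. g i [^] h i)"
      using A gA by (intro finprod_cong') auto
    finally show ?thesis using gk by (simp add: pow_mod_exponent)
  qed
  show ?thesis
    unfolding product_law_def residue_pmf_def Pi_pmf_insert[OF A]
    by (simp add: pair_pmf_def map_bind_pmf bind_map_pmf map_pmf_comp upd map_pmf_def[symmetric]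
          bind_return_pmf bind_assoc_pmf del: fun_upd_apply)
qed

text \<open>Convolution with the law of one further factor; the inductions on the index set for the
  Fourier bound and for the coset bound both run on this recursion.\<close>

lemma pmf_product_law_insert:
  assumes A: "finite A" "k \<notin> A" and g: "g \<in> insert k A \<rightarrow> carrier G" and z: "z \<in> carrier G"
  shows "pmf (product_law (insert k A) p g) z =
           (\<Sum>d<a. pmf (residue_pmf a (p k)) d * pmf (product_law A p g) (inv (g k [^] d) \<otimes> z))"
proof -
  have gk: "g k \<in> carrier G" and gA: "g \<in> A \<rightarrow> carrier G" using g by auto
  have "pmf (product_law (insert k A) p g) z =
      measure_pmf.expectation (residue_pmf a (p k))
        (\<lambda>d. pmf (map_pmf (\<lambda>y. g k [^] d \<otimes> y) (product_law A p g)) z)"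
    by (simp add: product_law_insert[OF A g] pmf_bind)
  also have "\<dots> = (\<Sum>d<a. pmf (map_pmf (\<lambda>y. g k [^] d \<otimes> y) (product_law A p g)) z * pmf (residue_pmf a (p k)) d)"
    using set_residue_pmf[OF exponent_pos] by (intro integral_measure_pmf_real) auto
  also have "\<dots> = (\<Sum>d<a. pmf (residue_pmf a (p k)) d * pmf (product_law A p g) (inv (g k [^] d) \<otimes> z))"
    using gk z set_product_law[OF gA] by (intro sum.cong refl) (simp add: pmf_translate)
  finally show ?thesis .
qed

text \<open>A Fourier transform along the cyclic group generated by \<open>s\<close> only. Adjoining a factor \<open>s ^ d\<close> to the
  product multiplies it by \<open>E w ^ d\<close>, and adjoining any other factor averages its translates, so no
  characters of \<open>G\<close> itself are needed.\<close>
definition cyclic_transform :: "('a \<Rightarrow> real) \<Rightarrow> 'a \<Rightarrow> complex \<Rightarrow> 'a \<Rightarrow> complex" where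
  "cyclic_transform q s w z = (\<Sum>m<a. w ^ m * of_real (q (z \<otimes> s [^] m)))"

text \<open>The sum over \<open>m < a\<close> is cyclic, because \<open>w ^ a = 1\<close> and
  \<open>s [^] a = \<one>\<close>; shifting \<open>m\<close> by one pulls out a factor
  \<open>w\<close>.\<close>

lemma cyclic_transform_shift:
  assumes s: "s \<in> carrier G" and z: "z \<in> carrier G" and w: "w ^ a = 1"
  shows "cyclic_transform q s w z = w * cyclic_transform q s w (z \<otimes> s)"
proof -
  define h where "h m = w ^ m * complex_of_real (q (z \<otimes> s [^] m))" for m :: nat
  have ends: "h a = h 0" using w s by (simp add: h_def pow_exponent)
  have "(\<Sum>m<a. h m) + h a = h 0 + (\<Sum>m<a. h (Suc m))"
    using sum.lessThan_Suc_shift[of h a] by simp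
  then have "(\<Sum>m<a. h m) = (\<Sum>m<a. h (Suc m))" using ends by simp
  also have "\<dots> = w * cyclic_transform q s w (z \<otimes> s)"
    unfolding cyclic_transform_def h_def sum_distrib_left
  proof (intro sum.cong refl)
    fix m
    have "z \<otimes> s [^] Suc m = z \<otimes> s \<otimes> s [^] m"
      using s z m_comm[of "s [^] m" s] by (simp add: m_assoc)
    then show "w ^ Suc m * complex_of_real (q (z \<otimes> s [^] Suc m)) = w * (w ^ m * complex_of_real (q (z \<otimes> s \<otimes> s [^] m)))"
      by (simp only: power_Suc mult.assoc)
  qed
  finally show ?thesis by (simp add: cyclic_transform_def h_def)
qed

lemma cyclic_transform_shift_pow:
  assumes s: "s \<in> carrier G" and z: "z \<in> carrier G" and w: "w ^ a = 1"
  shows "cyclic_transform q s w (inv (s [^] d) \<otimes> z) = w ^ d * cyclic_transform q s w z"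
proof (induction d)
  case (Suc d)
  have 1: "inv (s [^] Suc d) \<otimes> z \<otimes> s = inv (s [^] d) \<otimes> z"
  proof -
    have "inv (s [^] Suc d) \<otimes> z \<otimes> s = inv (s [^] d) \<otimes> inv s \<otimes> z \<otimes> s"
      using s by (simp add: inv_mult)
    also have "\<dots> = inv (s [^] d) \<otimes> z \<otimes> (inv s \<otimes> s)"
      using s z m_comm[of "inv s" z] by (simp add: m_assoc)
    finally show ?thesis using s z by simp
  qed
  have "cyclic_transform q s w (inv (s [^] Suc d) \<otimes> z) = w * cyclic_transform q s w (inv (s [^] d) \<otimes> z)"
    using cyclic_transform_shift[of s "inv (s [^] Suc d) \<otimes> z" w q] s z w
    by (simp only: 1) simp
  then show ?case using Suc by simp
qed (use z in simp)

lemma cyclic_transform_product_law_insert: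
  assumes A: "finite A" "k \<notin> A" and g: "g \<in> insert k A \<rightarrow> carrier G"
    and s: "s \<in> carrier G" and z: "z \<in> carrier G"
  shows "cyclic_transform (pmf (product_law (insert k A) p g)) s w z =
     (\<Sum>d<a. of_real (pmf (residue_pmf a (p k)) d) *
        cyclic_transform (pmf (product_law A p g)) s w (inv (g k [^] d) \<otimes> z))"
proof -
  have gk: "g k \<in> carrier G" using g by auto
  have "cyclic_transform (pmf (product_law (insert k A) p g)) s w z =
      (\<Sum>m<a. \<Sum>d<a. of_real (pmf (residue_pmf a (p k)) d) * (w ^ m *
         of_real (pmf (product_law A p g) (inv (g k [^] d) \<otimes> z \<otimes> s [^] m))))"
    unfolding cyclic_transform_def
    using s z gk by (intro sum.cong refl)
      (simp add: pmf_product_law_insert[OF A g] sum_distrib_left m_assoc mult_ac)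
  also have "\<dots> = (\<Sum>d<a. \<Sum>m<a. of_real (pmf (residue_pmf a (p k)) d) * (w ^ m *
         of_real (pmf (product_law A p g) (inv (g k [^] d) \<otimes> z \<otimes> s [^] m))))"
    by (rule sum.swap)
  finally show ?thesis by (simp add: cyclic_transform_def sum_distrib_left)
qed

text \<open>The bound holds for all \<open>z\<close> at once, so averaging over translates preserves
  it. The constant \<open>a\<close> is the trivial bound on the \<open>a\<close> terms of the
  transform of the empty product.\<close>

lemma cyclic_transform_product_law_bound:
  assumes \<rho>: "0 < \<rho>" "\<rho> < 1"
    and contr: "\<And>Y. balanced_rv eps Y \<Longrightarrow> cmod (\<Sum>d<a. of_real (pmf (residue_pmf a Y) d) * w ^ d) \<le> \<rho>"
    and w: "w ^ a = 1" and s: "s \<in> carrier G"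
    and "finite A" "g \<in> A \<rightarrow> carrier G" "\<And>k. k \<in> A \<Longrightarrow> balanced_rv eps (p k)" "z \<in> carrier G"
  shows "cmod (cyclic_transform (pmf (product_law A p g)) s w z) \<le> real a * \<rho> ^ card {k\<in>A. g k = s}"
  using assms(6-9)
proof (induction A arbitrary: z rule: finite_induct)
  case empty
  have norm_w: "cmod w = 1" using w exponent_pos power_eq_imp_eq_norm[of w a 1] by auto
  have "cmod (cyclic_transform (pmf (product_law {} p g)) s w z) \<le> (\<Sum>m<a. 1)"
    unfolding cyclic_transform_def
    by (rule sum_norm_le) (simp add: norm_mult norm_power norm_w pmf_le_1)
  then show ?case by simp
next
  case (insert k A)
  let ?\<phi> = "cyclic_transform (pmf (product_law A p g)) s w"
  have g: "g \<in> insert k A \<rightarrow> carrier G" by fact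
  then have gk: "g k \<in> carrier G" and gA: "g \<in> A \<rightarrow> carrier G" by auto
  have IH: "cmod (?\<phi> z) \<le> real a * \<rho> ^ card {k\<in>A. g k = s}" if "z \<in> carrier G" for z
    using insert.IH[OF gA _ that] insert.prems by blast
  note rec = cyclic_transform_product_law_insert[OF insert.hyps g s insert.prems(3), of p w]
  show ?case
  proof (cases "g k = s")
    case True
    have "{i \<in> insert k A. g i = s} = insert k {i\<in>A. g i = s}" using True by auto
    then have card: "card {i \<in> insert k A. g i = s} = Suc (card {i\<in>A. g i = s})"
      using insert.hyps by simp
    have "cyclic_transform (pmf (product_law (insert k A) p g)) s w z =
        (\<Sum>d<a. of_real (pmf (residue_pmf a (p k)) d) * w ^ d) * ?\<phi> z"
      unfolding rec True using s insert.prems(3) w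
      by (simp add: cyclic_transform_shift_pow sum_distrib_right mult.assoc)
    then have "cmod (cyclic_transform (pmf (product_law (insert k A) p g)) s w z) \<le>
        \<rho> * (real a * \<rho> ^ card {k\<in>A. g k = s})"
      unfolding norm_mult using \<rho> by (simp only: norm_mult) (intro mult_mono contr IH insert.prems, auto)
    then show ?thesis unfolding card by (simp add: mult_ac)
  next
    case False
    then have card: "{i \<in> insert k A. g i = s} = {i\<in>A. g i = s}" by auto
    have "cmod (cyclic_transform (pmf (product_law (insert k A) p g)) s w z) \<le>
        (\<Sum>d<a. pmf (residue_pmf a (p k)) d * (real a * \<rho> ^ card {k\<in>A. g k = s}))"
      unfolding rec using gk insert.prems(3)
      by (intro sum_norm_le) (auto simp: norm_mult intro!: mult_left_mono IH)
    also have "\<dots> = real a * \<rho> ^ card {k\<in>A. g k = s}"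
      by (simp add: sum_distrib_right[symmetric] sum_residue_pmf[OF exponent_pos])
    finally show ?thesis unfolding card .
  qed
qed

text \<open>Fourier inversion: summing over all \<open>a\<close>-th roots of unity annihilates every
  \<open>m\<close> except \<open>0\<close>.\<close>

lemma sum_cyclic_transform:
  assumes "s \<in> carrier G" "z \<in> carrier G"
  shows "(\<Sum>w | w ^ a = 1. cyclic_transform q s w z) = of_nat a * of_real (q z)"
proof -
  have "(\<Sum>w | w ^ a = 1. cyclic_transform q s w z) =
      (\<Sum>m<a. (\<Sum>w | w ^ a = 1. w ^ m) * of_real (q (z \<otimes> s [^] m)))"
    unfolding cyclic_transform_def sum_distrib_right by (rule sum.swap)
  also have "\<dots> = (\<Sum>m\<in>{0}. (\<Sum>w | w ^ a = 1. w ^ m) * of_real (q (z \<otimes> s [^] m)))"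
    using exponent_pos by (intro sum.mono_neutral_right) (auto simp: sum_powers_roots_unity)
  also have "\<dots> = of_nat a * of_real (q z)"
    using assms card_roots_unity_eq[OF exponent_pos] by simp
  finally show ?thesis .
qed

text \<open>Inversion expresses the difference at \<open>z \<otimes> s\<close> and \<open>z\<close>
  through the transforms. The term \<open>w = 1\<close> cancels exactly, because that transform is
  invariant under translation by \<open>s\<close>; every other root contributes at most twice the
  contraction bound. Thus a quotient occurring often makes the law nearly invariant under
  it.\<close>

lemma product_law_smooth:
  assumes \<rho>: "0 < \<rho>" "\<rho> < 1"
    and contr: "\<And>w Y. w ^ a = 1 \<Longrightarrow> w \<noteq> 1 \<Longrightarrow> balanced_rv eps Y \<Longrightarrow>
           cmod (\<Sum>d<a. of_real (pmf (residue_pmf a Y) d) * w ^ d) \<le> \<rho>"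
    and s: "s \<in> carrier G" and z: "z \<in> carrier G"
    and A: "finite A" "g \<in> A \<rightarrow> carrier G" "\<And>k. k \<in> A \<Longrightarrow> balanced_rv eps (p k)"
  shows "\<bar>pmf (product_law A p g) (z \<otimes> s) - pmf (product_law A p g) z\<bar>
           \<le> 2 * real a * \<rho> ^ card {k\<in>A. g k = s}"
proof -
  let ?q = "pmf (product_law A p g)"
  let ?R = "{w::complex. w ^ a = 1}"
  let ?b = "real a * \<rho> ^ card {k\<in>A. g k = s}"
  have fin: "finite ?R" using finite_roots_unity[of a, where 'a = complex] exponent_pos by simp
  have le: "cmod (cyclic_transform ?q s w (z \<otimes> s) - cyclic_transform ?q s w z) \<le> 2 * ?b"
    if w: "w \<in> ?R" for w
  proof (cases "w = 1")
    case True
    then show ?thesis using cyclic_transform_shift[OF s z, of 1 ?q] \<rho> by simp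
  next
    case False
    have "cmod (cyclic_transform ?q s w x) \<le> ?b" if "x \<in> carrier G" for x
      using w False contr by (intro cyclic_transform_product_law_bound[OF \<rho> _ _ s A that]) auto
    then have "cmod (cyclic_transform ?q s w (z \<otimes> s)) \<le> ?b" "cmod (cyclic_transform ?q s w z) \<le> ?b"
      using s z by auto
    then show ?thesis using norm_triangle_ineq4[of "cyclic_transform ?q s w (z \<otimes> s)" "cyclic_transform ?q s w z"]
      by linarith
  qed
  have "real a * \<bar>?q (z \<otimes> s) - ?q z\<bar> = cmod (of_nat a * of_real (?q (z \<otimes> s)) - of_nat a * of_real (?q z))"
    by (simp add: norm_mult flip: right_diff_distrib of_real_diff)
  also have "\<dots> = cmod (\<Sum>w\<in>?R. cyclic_transform ?q s w (z \<otimes> s) - cyclic_transform ?q s w z)"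
    using s z by (simp add: sum_subtractf sum_cyclic_transform)
  also have "\<dots> \<le> (\<Sum>w\<in>?R. 2 * ?b)" by (rule sum_norm_le) (rule le)
  also have "\<dots> = real a * (2 * ?b)" using card_roots_unity_eq[OF exponent_pos] by simp
  finally show ?thesis using exponent_pos by (simp add: mult.assoc)
qed

end

section \<open>Near invariance under generators, and averages over subgroups and cosets\<close>

context finite_exponent_group
begin

text \<open>A word in \<open>l\<close> generators and inverses moves \<open>q\<close> by at most
  \<open>l\<close> small steps. The number \<open>l\<close> is fixed before \<open>q\<close> and
  \<eta>, so it depends only on \<open>S\<close> and \<open>x\<close>.\<close>

lemma generate_smooth:
  assumes S: "S \<subseteq> carrier G" and "x \<in> generate G S"
  shows "\<exists>l::nat. \<forall>(q :: 'a \<Rightarrow> real) \<eta>. \<eta> \<ge> 0 \<longrightarrow> (\<forall>z\<in>carrier G. \<forall>s\<in>S. \<bar>q (z \<otimes> s) - q z\<bar> \<le> \<eta>) \<longrightarrow>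
           (\<forall>z\<in>carrier G. \<bar>q (z \<otimes> x) - q z\<bar> \<le> l * \<eta>)"
  using assms(2)
proof induction
  case one
  then show ?case by auto
next
  case (incl h)
  then show ?case by (intro exI[of _ 1]) auto
next
  case (inv h)
  show ?case
  proof (intro exI[of _ 1] allI impI ballI)
    fix q :: "'a \<Rightarrow> real" and \<eta> z
    assume *: "\<forall>z\<in>carrier G. \<forall>s\<in>S. \<bar>q (z \<otimes> s) - q z\<bar> \<le> \<eta>" and z: "z \<in> carrier G"
    have h: "h \<in> carrier G" using inv S by blast
    have "z \<otimes> inv h \<otimes> h = z" using h z by (simp add: m_assoc)
    moreover have "\<bar>q (z \<otimes> inv h \<otimes> h) - q (z \<otimes> inv h)\<bar> \<le> \<eta>" using * h z inv by auto
    ultimately show "\<bar>q (z \<otimes> inv h) - q z\<bar> \<le> real 1 * \<eta>" by (simp add: abs_minus_commute)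
  qed
next
  case (eng h1 h2)
  obtain l1 where l1: "\<And>(q :: 'a \<Rightarrow> real) \<eta> z. \<eta> \<ge> 0 \<Longrightarrow> (\<forall>z\<in>carrier G. \<forall>s\<in>S. \<bar>q (z \<otimes> s) - q z\<bar> \<le> \<eta>) \<Longrightarrow>
           z\<in>carrier G \<Longrightarrow> \<bar>q (z \<otimes> h1) - q z\<bar> \<le> real l1 * \<eta>" using eng.IH(1) by blast
  obtain l2 where l2: "\<And>(q :: 'a \<Rightarrow> real) \<eta> z. \<eta> \<ge> 0 \<Longrightarrow> (\<forall>z\<in>carrier G. \<forall>s\<in>S. \<bar>q (z \<otimes> s) - q z\<bar> \<le> \<eta>) \<Longrightarrow>
           z\<in>carrier G \<Longrightarrow> \<bar>q (z \<otimes> h2) - q z\<bar> \<le> real l2 * \<eta>" using eng.IH(2) by blast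
  have h: "h1 \<in> carrier G" "h2 \<in> carrier G" using eng.hyps generate_in_carrier[OF S] by blast+
  show ?case
  proof (intro exI[of _ "l1 + l2"] allI impI ballI)
    fix q :: "'a \<Rightarrow> real" and \<eta> z
    assume *: "\<eta> \<ge> 0" "\<forall>z\<in>carrier G. \<forall>s\<in>S. \<bar>q (z \<otimes> s) - q z\<bar> \<le> \<eta>" and z: "z \<in> carrier G"
    have 1: "\<bar>q (z \<otimes> h1) - q z\<bar> \<le> real l1 * \<eta>" by (rule l1[OF * z])
    have 2: "\<bar>q (z \<otimes> h1 \<otimes> h2) - q (z \<otimes> h1)\<bar> \<le> real l2 * \<eta>"
      using z h by (intro l2[OF *]) auto
    have "z \<otimes> (h1 \<otimes> h2) = z \<otimes> h1 \<otimes> h2" using z h by (simp add: m_assoc)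
    then show "\<bar>q (z \<otimes> (h1 \<otimes> h2)) - q z\<bar> \<le> real (l1 + l2) * \<eta>"
      using 1 2 by (simp add: distrib_right)
  qed
qed

text \<open>There are finitely many pairs \<open>(S, x)\<close> in a finite group, so the sum of all
  their word lengths serves for every pair.\<close>

lemma generate_smooth_uniform:
  "\<exists>L::nat. \<forall>S x (q :: 'a \<Rightarrow> real) \<eta>. S \<subseteq> carrier G \<longrightarrow> x \<in> generate G S \<longrightarrow> \<eta> \<ge> 0 \<longrightarrow>
     (\<forall>z\<in>carrier G. \<forall>s\<in>S. \<bar>q (z \<otimes> s) - q z\<bar> \<le> \<eta>) \<longrightarrow> (\<forall>z\<in>carrier G. \<bar>q (z \<otimes> x) - q z\<bar> \<le> L * \<eta>)"
proof -
  let ?P = "\<lambda>S x l. \<forall>(q :: 'a \<Rightarrow> real) \<eta>. \<eta> \<ge> 0 \<longrightarrow> (\<forall>z\<in>carrier G. \<forall>s\<in>S. \<bar>q (z \<otimes> s) - q z\<bar> \<le> \<eta>) \<longrightarrow>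
           (\<forall>z\<in>carrier G. \<bar>q (z \<otimes> x) - q z\<bar> \<le> real l * \<eta>)"
  have "\<forall>S x. \<exists>l. S \<subseteq> carrier G \<longrightarrow> x \<in> generate G S \<longrightarrow> ?P S x l" using generate_smooth by meson
  then obtain l where l: "\<And>S x. S \<subseteq> carrier G \<Longrightarrow> x \<in> generate G S \<Longrightarrow> ?P S x (l S x)" by metis
  let ?I = "Pow (carrier G) \<times> carrier G"
  define L where "L = (\<Sum>(S, x)\<in>?I. l S x)"
  have "\<bar>q (z \<otimes> x) - q z\<bar> \<le> L * \<eta>"
    if S: "S \<subseteq> carrier G" and x: "x \<in> generate G S" and \<eta>: "\<eta> \<ge> 0"
      and q: "\<forall>z\<in>carrier G. \<forall>s\<in>S. \<bar>q (z \<otimes> s) - q z\<bar> \<le> \<eta>" and z: "z \<in> carrier G"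
    for S x and q :: "'a \<Rightarrow> real" and \<eta> :: real and z
  proof -
    have "(S, x) \<in> ?I" using S generate_in_carrier[OF S x] by auto
    then have "l S x \<le> L" unfolding L_def
      using member_le_sum[of "(S, x)" ?I "\<lambda>(S, x). l S x"] finite_carrier by simp
    then have "real (l S x) * \<eta> \<le> L * \<eta>" using \<eta> by (simp add: mult_right_mono)
    moreover have "\<bar>q (z \<otimes> x) - q z\<bar> \<le> real (l S x) * \<eta>" using l[OF S x] \<eta> q z by blast
    ultimately show ?thesis by linarith
  qed
  then show ?thesis by blast
qed

text \<open>Near invariance under \<open>S\<close> extends to the generated subgroup, so the value
  at \<open>\<one>\<close> is close to each value there and hence to their mean. The comparison is
  with the mass of the subgroup and not with \<open>1\<close>, so that it also serves for labellings
  near a proper coset.\<close>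

lemma product_law_near_average:
  assumes eps: "eps > 0"
  shows "\<exists>\<rho> M. 0 < \<rho> \<and> \<rho> < 1 \<and> M > 0 \<and> (\<forall>(A :: 'k set) p g S N. finite A \<longrightarrow> g \<in> A \<rightarrow> carrier G \<longrightarrow>
     (\<forall>k\<in>A. balanced_rv eps (p k)) \<longrightarrow> S \<subseteq> carrier G \<longrightarrow> (\<forall>s\<in>S. N \<le> card {k\<in>A. g k = s}) \<longrightarrow>
     \<bar>pmf (product_law A p g) \<one> - (\<Sum>h\<in>generate G S. pmf (product_law A p g) h) / card (generate G S)\<bar>
       \<le> M * \<rho> ^ N)"
proof -
  obtain \<rho> where \<rho>: "0 < \<rho>" "\<rho> < 1" and contr: "\<And>w Y. w ^ a = 1 \<Longrightarrow> w \<noteq> 1 \<Longrightarrow> balanced_rv eps Y \<Longrightarrow>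
           cmod (\<Sum>d<a. of_real (pmf (residue_pmf a Y) d) * w ^ d) \<le> \<rho>"
    using balanced_character_contraction[OF exponent_pos eps] by blast
  obtain L :: nat where L: "\<forall>S x (q :: 'a \<Rightarrow> real) (\<eta>::real). S \<subseteq> carrier G \<longrightarrow> x \<in> generate G S \<longrightarrow> \<eta> \<ge> 0 \<longrightarrow>
     (\<forall>z\<in>carrier G. \<forall>s\<in>S. \<bar>q (z \<otimes> s) - q z\<bar> \<le> \<eta>) \<longrightarrow> (\<forall>z\<in>carrier G. \<bar>q (z \<otimes> x) - q z\<bar> \<le> L * \<eta>)"
    using generate_smooth_uniform by (rule exE)
  \<comment> \<open>The summand \<open>1\<close> keeps \<open>M\<close> positive even if
    \<open>L = 0\<close>.\<close>
  define M where "M = (real L + 1) * (2 * real a)"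
  have M: "M > 0" using exponent_pos by (simp add: M_def)
  have "\<bar>pmf (product_law A p g) \<one> - (\<Sum>h\<in>generate G S. pmf (product_law A p g) h) / card (generate G S)\<bar>
       \<le> M * \<rho> ^ N"
    if A: "finite A" "g \<in> A \<rightarrow> carrier G" and bal: "\<forall>k\<in>A. balanced_rv eps (p k)"
      and S: "S \<subseteq> carrier G" and N: "\<forall>s\<in>S. N \<le> card {k\<in>A. g k = s}"
    for A :: "'k set" and p g S N
  proof -
    let ?q = "pmf (product_law A p g)"
    let ?H = "generate G S"
    have H: "?H \<subseteq> carrier G" using generate_incl[OF S] .
    then have finH: "finite ?H" using finite_carrier finite_subset by blast
    have cH: "card ?H > 0" using finH generate.one[of G S] by (auto simp: card_gt_0_iff)
    have smooth: "\<forall>z\<in>carrier G. \<forall>s\<in>S. \<bar>?q (z \<otimes> s) - ?q z\<bar> \<le> 2 * real a * \<rho> ^ N"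
    proof (intro ballI)
      fix z s assume zs: "z \<in> carrier G" "s \<in> S"
      then have "\<bar>?q (z \<otimes> s) - ?q z\<bar> \<le> 2 * real a * \<rho> ^ card {k\<in>A. g k = s}"
        using S A bal by (intro product_law_smooth[OF \<rho> contr]) auto
      also have "\<dots> \<le> 2 * real a * \<rho> ^ N"
        using N zs \<rho> by (intro mult_left_mono power_decreasing) auto
      finally show "\<bar>?q (z \<otimes> s) - ?q z\<bar> \<le> 2 * real a * \<rho> ^ N" .
    qed
    have near: "\<bar>?q \<one> - ?q h\<bar> \<le> M * \<rho> ^ N" if h: "h \<in> ?H" for h
    proof -
      have "\<bar>?q (\<one> \<otimes> h) - ?q \<one>\<bar> \<le> L * (2 * real a * \<rho> ^ N)"
        using L[THEN spec, THEN spec, THEN spec, THEN spec, THEN mp, OF S, THEN mp, OF h, THEN mp, THEN mp, OF _ smooth] \<rho>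
        by auto
      also have "\<dots> \<le> (L + 1) * (2 * real a * \<rho> ^ N)" using \<rho> by (intro mult_right_mono) auto
      finally show ?thesis using h H by (simp add: M_def subset_iff abs_minus_commute algebra_simps)
    qed
    have "?q \<one> - (\<Sum>h\<in>?H. ?q h) / card ?H = (\<Sum>h\<in>?H. ?q \<one> - ?q h) / card ?H"
      using cH by (simp add: sum_subtractf field_simps)
    also have "\<bar>\<dots>\<bar> \<le> (\<Sum>h\<in>?H. M * \<rho> ^ N) / card ?H"
      using near cH by (simp add: abs_divide del: sum_constant)
        (intro divide_right_mono order_trans[OF sum_abs] sum_mono, auto)
    also have "\<dots> = M * \<rho> ^ N" using cH by simp
    finally show ?thesis .
  qed
  then show ?thesis by (intro exI[of _ \<rho>] exI[of _ M] conjI allI impI \<rho> M)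
qed

text \<open>Fix all factors except one with \<open>g k\<close> outside \<open>H\<close>: the product
  falls into a given coset of \<open>H\<close> only if \<open>d k\<close> lies in one coset of the
  proper subgroup of exponents \<open>m\<close> with \<open>g k [^] m\<close> in \<open>H\<close>.
  The induction looks for such a factor; a factor inside \<open>H\<close> merely averages the claim
  over translates of \<open>z\<close>.\<close>

lemma product_law_coset_le:
  assumes H: "subgroup H G" and "finite A" "g \<in> A \<rightarrow> carrier G" "\<And>k. k \<in> A \<Longrightarrow> balanced_rv eps (p k)"
    and "\<exists>k\<in>A. g k \<notin> H" and "z \<in> carrier G"
  shows "(\<Sum>h\<in>H. pmf (product_law A p g) (z \<otimes> h)) \<le> 1 - eps"
  using assms(2-6)
proof (induction A arbitrary: z rule: finite_induct)
  case (insert k A)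
  let ?q = "pmf (product_law A p g)"
  let ?c = "pmf (residue_pmf a (p k))"
  have HG: "H \<subseteq> carrier G" using H by (rule subgroup.subset)
  then have finH: "finite H" using finite_carrier finite_subset by blast
  have g: "g \<in> insert k A \<rightarrow> carrier G" by fact
  then have gk: "g k \<in> carrier G" and gA: "g \<in> A \<rightarrow> carrier G" by auto
  have z: "z \<in> carrier G" by fact
  have "(\<Sum>h\<in>H. pmf (product_law (insert k A) p g) (z \<otimes> h)) =
      (\<Sum>h\<in>H. \<Sum>d<a. ?c d * ?q (inv (g k [^] d) \<otimes> z \<otimes> h))"
    using z HG gk by (intro sum.cong refl) (auto simp: pmf_product_law_insert[OF insert.hyps g] m_assoc)
  also have "\<dots> = (\<Sum>d<a. ?c d * (\<Sum>h\<in>H. ?q (inv (g k [^] d) \<otimes> z \<otimes> h)))"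
    unfolding sum_distrib_left by (rule sum.swap)
  finally have rec: "(\<Sum>h\<in>H. pmf (product_law (insert k A) p g) (z \<otimes> h)) = \<dots>" .
  show ?case
  proof (cases "g k \<in> H")
    case True
    then have "(\<Sum>d<a. ?c d * (\<Sum>h\<in>H. ?q (inv (g k [^] d) \<otimes> z \<otimes> h))) \<le> (\<Sum>d<a. ?c d * (1 - eps))"
      using insert gk gA z by (intro sum_mono mult_left_mono insert.IH) auto
    also have "\<dots> = 1 - eps" by (simp add: sum_distrib_right[symmetric] sum_residue_pmf[OF exponent_pos])
    finally show ?thesis unfolding rec .
  next
    case False
    \<comment> \<open>\<open>v\<close> stands for the product of the remaining factors, and
      \<open>?T v d\<close> lies in \<open>H\<close> exactly when
      \<open>g k [^] d \<otimes> v\<close> lies in the coset of \<open>z\<close>. Exchanging the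
      sums then conditions on \<open>v\<close>.\<close>
    let ?T = "\<lambda>v d. inv (inv (g k [^] (d::nat)) \<otimes> z) \<otimes> v"
    have coset: "(\<Sum>h\<in>H. ?q (inv (g k [^] d) \<otimes> z \<otimes> h)) = (\<Sum>v\<in>carrier G. ?q v * of_bool (?T v d \<in> H))" for d
    proof -
      define y where "y = inv (g k [^] d) \<otimes> z"
      have y: "y \<in> carrier G" using gk z by (simp add: y_def)
      have "(\<Sum>h\<in>H. ?q (y \<otimes> h)) = (\<Sum>v\<in>{v\<in>carrier G. inv y \<otimes> v \<in> H}. ?q v)"
      proof (rule sum.reindex_bij_witness[of _ "\<lambda>v. inv y \<otimes> v" "\<lambda>h. y \<otimes> h"])
        fix h assume "h \<in> H"
        then have "h \<in> carrier G" using HG by blast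
        then show 1: "inv y \<otimes> (y \<otimes> h) = h" using y by (simp add: m_assoc[symmetric])
        show "y \<otimes> h \<in> {v \<in> carrier G. inv y \<otimes> v \<in> H}"
          using 1 y \<open>h \<in> carrier G\<close> \<open>h \<in> H\<close> by auto
      next
        fix v assume "v \<in> {v \<in> carrier G. inv y \<otimes> v \<in> H}"
        then show "y \<otimes> (inv y \<otimes> v) = v" "inv y \<otimes> v \<in> H"
          using y by (auto simp: m_assoc[symmetric])
      qed auto
      also have "\<dots> = (\<Sum>v\<in>carrier G. ?q v * of_bool (inv y \<otimes> v \<in> H))"
        using finite_carrier by (intro sum.mono_neutral_cong_left) auto
      finally show ?thesis by (simp add: y_def)
    qed
    have weight: "(\<Sum>d<a. ?c d * of_bool (?T v d \<in> H)) \<le> 1 - eps" if v: "v \<in> carrier G" for v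
    proof -
      have T: "?T v d = g k [^] d \<otimes> (inv z \<otimes> v)" for d
        using gk z v by (simp add: inv_mult m_assoc)
      have "(\<Sum>d\<in>{d\<in>{..<a}. ?T v d \<in> H}. ?c d) \<le> 1 - eps"
      proof (rule sum_residue_pmf_coset_le[of eps "p k" "{m::int. g k [^] m \<in> H}"])
        show "x - y \<in> {m::int. g k [^] m \<in> H}" if "x \<in> {m::int. g k [^] m \<in> H}" "y \<in> {m::int. g k [^] m \<in> H}" for x y
          using that gk H by (simp add: int_pow_diff subgroup.m_closed subgroup.m_inv_closed)
        show "1 \<notin> {m::int. g k [^] m \<in> H}" using False gk by simp
        show "int a \<in> {m::int. g k [^] m \<in> H}"
          using gk H by (simp add: int_pow_int pow_exponent subgroup.one_closed)
        show "int x - int y \<in> {m::int. g k [^] m \<in> H}"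
          if "x \<in> {d\<in>{..<a}. ?T v d \<in> H}" "y \<in> {d\<in>{..<a}. ?T v d \<in> H}" for x y
        proof -
          define u where "u = inv z \<otimes> v"
          have u: "u \<in> carrier G" using z v by (simp add: u_def)
          have "g k [^] x \<otimes> u \<in> H" "g k [^] y \<otimes> u \<in> H" using that by (auto simp: T u_def)
          then have "(g k [^] x \<otimes> u) \<otimes> inv (g k [^] y \<otimes> u) \<in> H"
            using H by (simp add: subgroup.m_closed subgroup.m_inv_closed)
          also have "(g k [^] x \<otimes> u) \<otimes> inv (g k [^] y \<otimes> u) = g k [^] x \<otimes> inv (g k [^] y)"
            using gk u by (simp add: inv_mult_group m_assoc) (simp add: m_assoc[symmetric])
          finally show ?thesis using gk by (simp add: int_pow_diff int_pow_int)
        qed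
        show "balanced_rv eps (p k)" using insert.prems by auto
      qed auto
      moreover have "(\<Sum>d<a. ?c d * of_bool (?T v d \<in> H)) = (\<Sum>d\<in>{d\<in>{..<a}. ?T v d \<in> H}. ?c d)"
        by (rule sum.mono_neutral_cong_right) auto
      ultimately show ?thesis by linarith
    qed
    have "(\<Sum>d<a. ?c d * (\<Sum>h\<in>H. ?q (inv (g k [^] d) \<otimes> z \<otimes> h)))
        = (\<Sum>d<a. \<Sum>v\<in>carrier G. ?q v * (?c d * of_bool (?T v d \<in> H)))"
      by (simp only: coset sum_distrib_left mult.left_commute)
    also have "\<dots> = (\<Sum>v\<in>carrier G. ?q v * (\<Sum>d<a. ?c d * of_bool (?T v d \<in> H)))"
      unfolding sum_distrib_left by (rule sum.swap)
    also have "\<dots> \<le> (\<Sum>v\<in>carrier G. ?q v * (1 - eps))"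
      by (intro sum_mono mult_left_mono weight) auto
    also have "\<dots> = 1 - eps" by (simp add: sum_distrib_right[symmetric] sum_product_law[OF gA])
    finally show ?thesis unfolding rec .
  qed
qed auto

end

section \<open>Independence of the rows of the degree matrix\<close>

lemma Pi_pmf_Sigma:
  assumes J: "finite J" and A: "\<And>j. j \<in> J \<Longrightarrow> finite (A j)"
  shows "Pi_pmf (Sigma J A) dflt D =
    map_pmf case_prod (Pi_pmf J (\<lambda>_. dflt) (\<lambda>j. Pi_pmf (A j) dflt (\<lambda>k. D (j, k))))"
proof (rule pmf_eqI)
  fix h
  let ?M = "Pi_pmf J (\<lambda>_. dflt) (\<lambda>j. Pi_pmf (A j) dflt (\<lambda>k. D (j, k)))"
  have "inj (case_prod :: ('a \<Rightarrow> 'b \<Rightarrow> 'c) \<Rightarrow> _)" by (rule injI) (metis curry_case_prod)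
  then have "pmf (map_pmf case_prod ?M) (case_prod (curry h)) = pmf ?M (curry h)"
    by (rule pmf_map_inj')
  then have rhs: "pmf (map_pmf case_prod ?M) h = pmf ?M (curry h)" by simp
  show "pmf (Pi_pmf (Sigma J A) dflt D) h = pmf (map_pmf case_prod ?M) h"
  proof (cases "\<forall>x. x \<notin> Sigma J A \<longrightarrow> h x = dflt")
    case True
    have "pmf (Pi_pmf (Sigma J A) dflt D) h = (\<Prod>x\<in>Sigma J A. pmf (D x) (h x))"
      using True J A by (intro pmf_Pi') auto
    also have "\<dots> = (\<Prod>j\<in>J. \<Prod>k\<in>A j. pmf (D (j, k)) (h (j, k)))"
      using J A by (subst prod.Sigma) auto
    also have "\<dots> = (\<Prod>j\<in>J. pmf (Pi_pmf (A j) dflt (\<lambda>k. D (j, k))) (curry h j))"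
      using A True by (intro prod.cong refl) (subst pmf_Pi', auto)
    also have "\<dots> = pmf ?M (curry h)"
      using True J by (intro pmf_Pi'[symmetric]) auto
    finally show ?thesis using rhs by simp
  next
    case False
    then obtain j k where jk: "(j, k) \<notin> Sigma J A" "h (j, k) \<noteq> dflt" by auto
    have "pmf ?M (curry h) = 0"
    proof (cases "j \<in> J")
      case True
      then have "pmf (Pi_pmf (A j) dflt (\<lambda>k. D (j, k))) (curry h j) = 0"
        using jk A by (intro pmf_Pi_outside) auto
      then show ?thesis using True J by (auto simp: pmf_Pi prod_zero_iff)
    next
      case False
      then have "curry h j \<noteq> (\<lambda>_. dflt)" using jk by (auto simp: curry_def fun_eq_iff)
      then show ?thesis using False J by (intro pmf_Pi_outside) auto
    qed
    then show ?thesis using False J A rhs by (subst pmf_Pi_outside) auto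
  qed
qed

text \<open>The event \<open>R j\<close> looks only at the edges leaving \<open>j\<close>. Grouping
  the independent edges by their tail turns the digraph into a family of independent rows.\<close>

lemma prob_random_digraph_rows:
  "measure_pmf.prob (random_digraph n D) {deg. \<forall>j<n. R j (\<lambda>k. deg (j, k))} =
     (\<Prod>j<n. measure_pmf.prob (Pi_pmf ({..<n} - {j}) 0 (\<lambda>k. D (j, k))) {d. R j d})"
proof -
  have "offdiag n = Sigma {..<n} (\<lambda>j. {..<n} - {j})" by (auto simp: offdiag_def)
  then have "measure_pmf.prob (random_digraph n D) {deg. \<forall>j<n. R j (\<lambda>k. deg (j, k))} =
      measure_pmf.prob (Pi_pmf {..<n} (\<lambda>_. 0) (\<lambda>j. Pi_pmf ({..<n} - {j}) 0 (\<lambda>k. D (j, k))))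
        (case_prod -` {deg. \<forall>j<n. R j (\<lambda>k. deg (j, k))})"
    by (simp add: random_digraph_def Pi_pmf_Sigma measure_map_pmf)
  also have "case_prod -` {deg. \<forall>j<n. R j (\<lambda>k. deg (j, k))} = Pi {..<n} (\<lambda>j. {d. R j d})"
    by auto
  finally show ?thesis by (simp add: measure_Pi_pmf_Pi)
qed

section \<open>Surjections from the sandpile group as labellings\<close>

definition unit_diff :: "nat \<Rightarrow> nat \<Rightarrow> nat \<Rightarrow> int" where
  "unit_diff i j = (\<lambda>k. of_bool (k = i) - of_bool (k = j))"

lemma comm_group_Zn0: "comm_group (Zn0 n)"
proof (rule comm_groupI)
  fix x assume "x \<in> carrier (Zn0 n)"
  then show "\<exists>y\<in>carrier (Zn0 n). y \<otimes>\<^bsub>Zn0 n\<^esub> x = \<one>\<^bsub>Zn0 n\<^esub>"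
    by (intro bexI[of _ "\<lambda>i. - x i"]) (auto simp: Zn0_def sum_negf)
qed (auto simp: Zn0_def sum.distrib)

lemma unit_diff_in_Zn0: "i < n \<Longrightarrow> j < n \<Longrightarrow> unit_diff i j \<in> carrier (Zn0 n)"
  by (auto simp: Zn0_def unit_diff_def sum_subtractf)

lemma scale_in_Zn0: "v \<in> carrier (Zn0 n) \<Longrightarrow> (\<lambda>i. c * v i) \<in> carrier (Zn0 n)"
  by (auto simp: Zn0_def sum_distrib_left[symmetric])

lemma sum_in_Zn0:
  assumes "finite J" "\<And>j. j \<in> J \<Longrightarrow> u j \<in> carrier (Zn0 n)"
  shows "(\<lambda>i. \<Sum>j\<in>J. u j i) \<in> carrier (Zn0 n)"
  using assms by (induction J) (auto simp: Zn0_def sum.distrib)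

text \<open>Column \<open>j\<close> of the Laplacian as a combination of differences of basis
  vectors. In this form the entry sum is visibly zero, and a homomorphism turns the column into a
  product of quotients of labels.\<close>

definition lap_column :: "nat \<Rightarrow> (nat \<times> nat \<Rightarrow> nat) \<Rightarrow> nat \<Rightarrow> nat \<Rightarrow> int" where
  "lap_column n deg j = (\<lambda>i. \<Sum>k\<in>{..<n} - {j}. int (deg (j, k)) * unit_diff j k i)"

lemma lap_column_eq:
  assumes "j < n"
  shows "lap_column n deg j i = (if i < n then laplacian n deg i j else 0)"
proof (cases "i = j")
  case True
  have "lap_column n deg j i = (\<Sum>k\<in>{..<n} - {j}. int (deg (j, k)))"
    unfolding lap_column_def using True by (intro sum.cong) (auto simp: unit_diff_def)
  then show ?thesis using True assms by (simp add: laplacian_def)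
next
  case False
  have "lap_column n deg j i = (\<Sum>k\<in>{..<n} - {j}. if k = i then - int (deg (j, k)) else 0)"
    unfolding lap_column_def using False by (intro sum.cong) (auto simp: unit_diff_def)
  also have "\<dots> = (if i < n then - int (deg (j, i)) else 0)"
    using False by (subst sum.delta) auto
  finally show ?thesis using False by (simp add: laplacian_def)
qed

lemma lap_column_in_Zn0: "j < n \<Longrightarrow> lap_column n deg j \<in> carrier (Zn0 n)"
  unfolding lap_column_def by (intro sum_in_Zn0 scale_in_Zn0 unit_diff_in_Zn0) auto

lemma lap_image_eq: "lap_image n deg = {(\<lambda>i. \<Sum>j<n. x j * lap_column n deg j i) | x. True}"
proof -
  have "(\<lambda>i. if i < n then (\<Sum>j<n. laplacian n deg i j * x j) else 0) = (\<lambda>i. \<Sum>j<n. x j * lap_column n deg j i)" for x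
    by (auto simp: lap_column_eq mult.commute)
  then show ?thesis unfolding lap_image_def by simp
qed

lemma subgroup_lap_image: "subgroup (lap_image n deg) (Zn0 n)"
proof -
  interpret comm_group "Zn0 n" by (rule comm_group_Zn0)
  have carr: "(\<lambda>i. \<Sum>j<n. x j * lap_column n deg j i) \<in> carrier (Zn0 n)" for x
    by (intro sum_in_Zn0 scale_in_Zn0 lap_column_in_Zn0) auto
  show ?thesis
  proof (rule subgroupI)
    show "lap_image n deg \<subseteq> carrier (Zn0 n)" unfolding lap_image_eq using carr by auto
    show "lap_image n deg \<noteq> {}" unfolding lap_image_eq by auto
  next
    fix v assume "v \<in> lap_image n deg"
    then obtain x where v: "v = (\<lambda>i. \<Sum>j<n. x j * lap_column n deg j i)" unfolding lap_image_eq by auto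
    have "inv\<^bsub>Zn0 n\<^esub> v = (\<lambda>i. \<Sum>j<n. (- x j) * lap_column n deg j i)"
      using carr[of x] carr[of "\<lambda>j. - x j"] unfolding v
      by (intro inv_equality) (auto simp: Zn0_def sum_negf)
    then show "inv\<^bsub>Zn0 n\<^esub> v \<in> lap_image n deg" unfolding lap_image_eq by (intro CollectI exI[of _ "\<lambda>j. - x j"]) simp
  next
    fix v w assume "v \<in> lap_image n deg" "w \<in> lap_image n deg"
    then obtain x y where vw: "v = (\<lambda>i. \<Sum>j<n. x j * lap_column n deg j i)"
      "w = (\<lambda>i. \<Sum>j<n. y j * lap_column n deg j i)" unfolding lap_image_eq by auto
    have "v \<otimes>\<^bsub>Zn0 n\<^esub> w = (\<lambda>i. \<Sum>j<n. (x j + y j) * lap_column n deg j i)"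
      unfolding vw by (auto simp: Zn0_def sum.distrib distrib_right)
    then show "v \<otimes>\<^bsub>Zn0 n\<^esub> w \<in> lap_image n deg"
      unfolding lap_image_eq by (intro CollectI exI[of _ "\<lambda>j. x j + y j"]) simp
  qed
qed

lemma lap_column_in_lap_image:
  assumes "j < n"
  shows "lap_column n deg j \<in> lap_image n deg"
proof -
  have "lap_column n deg j = (\<lambda>i. \<Sum>l<n. of_bool (l = j) * lap_column n deg l i)"
    using assms by (simp add: of_bool_def if_distrib[of "\<lambda>c. c * _"] cong: if_cong)
  then show ?thesis unfolding lap_image_eq by (intro CollectI exI[of _ "\<lambda>l. of_bool (l = j)"] conjI TrueI)
qed

context comm_group
begin

text \<open>The homomorphism from Z^n to \<open>G\<close> that sends the basis vector of
  \<open>i\<close> to \<open>f i\<close>, defined on all vectors so that single basis vectors can be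
  evaluated too.\<close>

definition evaluate :: "nat \<Rightarrow> (nat \<Rightarrow> 'a) \<Rightarrow> (nat \<Rightarrow> int) \<Rightarrow> 'a" where
  "evaluate n f v = (\<Otimes>i\<in>{..<n}. f i [^] v i)"

lemma evaluate_closed: "f \<in> {..<n} \<rightarrow> carrier G \<Longrightarrow> evaluate n f v \<in> carrier G"
  unfolding evaluate_def by (intro finprod_closed) auto

lemma evaluate_add:
  assumes "f \<in> {..<n} \<rightarrow> carrier G"
  shows "evaluate n f (\<lambda>i. u i + v i) = evaluate n f u \<otimes> evaluate n f v"
proof -
  have "evaluate n f (\<lambda>i. u i + v i) = (\<Otimes>i\<in>{..<n}. f i [^] u i \<otimes> f i [^] v i)"
    unfolding evaluate_def using assms by (intro finprod_cong') (auto simp: int_pow_mult Pi_def)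
  then show ?thesis using assms unfolding evaluate_def by (subst (asm) finprod_multf) auto
qed

lemma evaluate_zero: "f \<in> {..<n} \<rightarrow> carrier G \<Longrightarrow> evaluate n f (\<lambda>i. 0) = \<one>"
  unfolding evaluate_def by simp

lemma evaluate_scale:
  assumes f: "f \<in> {..<n} \<rightarrow> carrier G"
  shows "evaluate n f (\<lambda>i. c * u i) = evaluate n f u [^] c"
proof -
  have nat: "evaluate n f (\<lambda>i. int m * u i) = evaluate n f u [^] int m" for m
  proof (induction m)
    case (Suc m)
    have "evaluate n f (\<lambda>i. int (Suc m) * u i) = evaluate n f (\<lambda>i. int m * u i + u i)"
      by (simp add: algebra_simps)
    then show ?case using evaluate_closed[OF f, of u] by (simp only: evaluate_add[OF f] Suc int_pow_int) simp
  qed (simp add: evaluate_zero[OF f])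
  show ?thesis
  proof (cases "c \<ge> 0")
    case True
    then show ?thesis using nat[of "nat c"] by simp
  next
    case False
    define m where "m = nat (- c)"
    have c: "c = - int m" using False by (simp add: m_def)
    have "evaluate n f (\<lambda>i. c * u i) \<otimes> evaluate n f (\<lambda>i. int m * u i) = \<one>"
      using evaluate_add[OF f, of "\<lambda>i. c * u i" "\<lambda>i. int m * u i"] evaluate_zero[OF f] by (simp add: c)
    then have "evaluate n f (\<lambda>i. c * u i) = inv (evaluate n f (\<lambda>i. int m * u i))"
      using evaluate_closed[OF f] by (metis inv_equality)
    then show ?thesis using evaluate_closed[OF f] by (simp add: nat c int_pow_neg)
  qed
qed

lemma evaluate_sum:
  assumes f: "f \<in> {..<n} \<rightarrow> carrier G" and "finite J"
  shows "evaluate n f (\<lambda>i. \<Sum>j\<in>J. u j i) = (\<Otimes>j\<in>J. evaluate n f (u j))"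
  using \<open>finite J\<close>
proof induction
  case (insert j J)
  have "evaluate n f (\<lambda>i. \<Sum>j\<in>insert j J. u j i) = evaluate n f (\<lambda>i. u j i + (\<Sum>j\<in>J. u j i))"
    using insert.hyps by simp
  also have "\<dots> = evaluate n f (u j) \<otimes> (\<Otimes>j\<in>J. evaluate n f (u j))"
    by (simp only: evaluate_add[OF f] insert.IH)
  also have "\<dots> = (\<Otimes>j\<in>insert j J. evaluate n f (u j))"
    using insert.hyps by (intro finprod_insert[symmetric]) (auto intro: evaluate_closed[OF f])
  finally show ?case .
qed (simp add: evaluate_zero[OF f])

lemma evaluate_unit:
  assumes f: "f \<in> {..<n} \<rightarrow> carrier G" and "i < n"
  shows "evaluate n f (\<lambda>k. of_bool (k = i)) = f i"
proof -
  have "evaluate n f (\<lambda>k. of_bool (k = i)) = (\<Otimes>k\<in>{..<n}. if i = k then f k else \<one>)"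
    unfolding evaluate_def using f by (intro finprod_cong') (auto simp: Pi_def)
  also have "\<dots> = f i" using assms by (intro finprod_singleton) auto
  finally show ?thesis .
qed

lemma evaluate_unit_diff:
  assumes f: "f \<in> {..<n} \<rightarrow> carrier G" and "i < n" "j < n"
  shows "evaluate n f (unit_diff i j) = f i \<otimes> inv f j"
proof -
  have "evaluate n f (unit_diff i j) = evaluate n f (\<lambda>k. of_bool (k = i) + (-1) * of_bool (k = j))"
    by (simp add: unit_diff_def)
  also have "\<dots> = f i \<otimes> f j [^] (-1 :: int)"
    unfolding evaluate_add[OF f] evaluate_scale[OF f] using assms by (simp add: evaluate_unit)
  also have "\<dots> = f i \<otimes> inv f j"
    using assms int_pow_neg[of "f j" 1] by (auto simp: Pi_def)
  finally show ?thesis .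
qed

text \<open>The bridge to the probability: the relation imposed by column \<open>j\<close> is the
  row product of vertex \<open>j\<close>, whose exponents are the degrees out of
  \<open>j\<close>.\<close>

lemma evaluate_lap_column:
  assumes f: "f \<in> {..<n} \<rightarrow> carrier G" and "j < n"
  shows "evaluate n f (lap_column n deg j) = (\<Otimes>k\<in>{..<n} - {j}. (f j \<otimes> inv f k) [^] deg (j, k))"
proof -
  have "evaluate n f (lap_column n deg j) =
      (\<Otimes>k\<in>{..<n} - {j}. evaluate n f (\<lambda>i. int (deg (j, k)) * unit_diff j k i))"
    unfolding lap_column_def by (rule evaluate_sum[OF f]) simp
  also have "\<dots> = (\<Otimes>k\<in>{..<n} - {j}. (f j \<otimes> inv f k) [^] deg (j, k))"
    using assms by (intro finprod_cong')
      (auto simp: evaluate_scale[OF f] evaluate_unit_diff[OF f] int_pow_int dest: funcset_mem)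
  finally show ?thesis .
qed

lemma evaluate_lap_image:
  assumes f: "f \<in> {..<n} \<rightarrow> carrier G" and v: "v \<in> lap_image n deg"
    and 1: "\<And>j. j < n \<Longrightarrow> evaluate n f (lap_column n deg j) = \<one>"
  shows "evaluate n f v = \<one>"
proof -
  obtain x where "v = (\<lambda>i. \<Sum>j<n. x j * lap_column n deg j i)" using v unfolding lap_image_eq by auto
  then have "evaluate n f v = (\<Otimes>j\<in>{..<n}. evaluate n f (\<lambda>i. x j * lap_column n deg j i))"
    using f by (simp add: evaluate_sum)
  then show ?thesis using f 1 by (simp add: evaluate_scale) (intro finprod_one_eqI, auto)
qed

text \<open>Restricting to vectors of sum zero loses nothing: as \<open>f 0 = \<one>\<close>, each
  label \<open>f i\<close> is already the value at \<open>unit_diff i 0\<close>.\<close>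

lemma evaluate_image:
  assumes f: "f \<in> {..<n} \<rightarrow> carrier G" and "n > 0" and f0: "f 0 = \<one>"
  shows "evaluate n f ` carrier (Zn0 n) = generate G (f ` {..<n})"
proof
  have fG: "f ` {..<n} \<subseteq> carrier G" using f by auto
  have sub: "subgroup (generate G (f ` {..<n})) G" by (rule generate_is_subgroup[OF fG])
  have "(\<Otimes>i\<in>I. f i [^] v i) \<in> generate G (f ` {..<n})" if "I \<subseteq> {..<n}" "finite I" for I and v :: "nat \<Rightarrow> int"
    using that(2,1)
  proof induction
    case empty
    then show ?case by (simp add: generate.one)
  next
    case (insert i I)
    have "f i [^] v i \<in> generate G (f ` {..<n})"
      using insert.prems by (intro subgroup_int_pow_closed[OF sub] generate.incl) auto
    moreover have "(\<Otimes>i\<in>insert i I. f i [^] v i) = f i [^] v i \<otimes> (\<Otimes>i\<in>I. f i [^] v i)"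
      using insert f by (intro finprod_insert) auto
    ultimately show ?case using insert by (auto intro: generate.eng)
  qed
  then show "evaluate n f ` carrier (Zn0 n) \<subseteq> generate G (f ` {..<n})"
    by (auto simp: evaluate_def)
  have hom: "evaluate n f \<in> hom (Zn0 n) G"
    using evaluate_closed[OF f] evaluate_add[OF f] by (auto simp: hom_def Zn0_def)
  interpret Z: comm_group "Zn0 n" by (rule comm_group_Zn0)
  have "group_hom (Zn0 n) G (evaluate n f)" using hom by unfold_locales
  then have img: "subgroup (evaluate n f ` carrier (Zn0 n)) G" by (rule group_hom.img_is_subgroup)
  have "f i \<in> evaluate n f ` carrier (Zn0 n)" if "i < n" for i
  proof -
    have "f i = evaluate n f (unit_diff i 0)"
      using f f0 that \<open>n > 0\<close> by (subst evaluate_unit_diff) (auto simp: Pi_def)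
    then show ?thesis using unit_diff_in_Zn0[OF that \<open>n > 0\<close>] by blast
  qed
  then show "generate G (f ` {..<n}) \<subseteq> evaluate n f ` carrier (Zn0 n)"
    using img by (intro generate_subgroup_incl) auto
qed

end

section \<open>Homomorphisms from the sandpile group\<close>

context comm_group
begin

lemma hom_Zn0_scale:
  assumes h: "h \<in> hom (Zn0 n) G" and u: "u \<in> carrier (Zn0 n)"
  shows "h (\<lambda>i. c * u i) = h u [^] c"
proof -
  have closed: "h v \<in> carrier G" if "v \<in> carrier (Zn0 n)" for v using h that by (auto simp: hom_def)
  have add: "h (\<lambda>i. v i + w i) = h v \<otimes> h w" if "v \<in> carrier (Zn0 n)" "w \<in> carrier (Zn0 n)" for v w
    using hom_mult[OF h that] by (simp add: Zn0_def)
  have zero: "h (\<lambda>i. 0) = \<one>"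
    using hom_one[OF h] comm_group_Zn0[of n] is_group by (simp add: Zn0_def comm_group_def)
  have nat: "h (\<lambda>i. int m * u i) = h u [^] int m" for m
  proof (induction m)
    case (Suc m)
    have "h (\<lambda>i. int (Suc m) * u i) = h (\<lambda>i. int m * u i + u i)"
      by (simp add: algebra_simps)
    also have "\<dots> = h u [^] int m \<otimes> h u"
      using add[OF scale_in_Zn0[OF u] u] Suc by simp
    finally show ?case by (simp only: int_pow_int) simp
  qed (simp add: zero)
  show ?thesis
  proof (cases "c \<ge> 0")
    case True
    then show ?thesis using nat[of "nat c"] by simp
  next
    case False
    define m where "m = nat (- c)"
    have c: "c = - int m" using False by (simp add: m_def)
    have "h (\<lambda>i. c * u i) \<otimes> h (\<lambda>i. int m * u i) = \<one>"
      using add[OF scale_in_Zn0[OF u] scale_in_Zn0[OF u], of c "int m"] zero by (simp add: c)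
    then have "h (\<lambda>i. c * u i) = inv (h (\<lambda>i. int m * u i))"
      using closed scale_in_Zn0[OF u] by (metis inv_equality)
    then show ?thesis using closed[OF u] by (simp add: nat c int_pow_neg)
  qed
qed

lemma hom_Zn0_sum:
  assumes h: "h \<in> hom (Zn0 n) G" and "finite J" and u: "\<And>j. j \<in> J \<Longrightarrow> u j \<in> carrier (Zn0 n)"
  shows "h (\<lambda>i. \<Sum>j\<in>J. u j i) = (\<Otimes>j\<in>J. h (u j))"
  using \<open>finite J\<close> u
proof induction
  case empty
  then show ?case
    using hom_one[OF h] comm_group_Zn0[of n] is_group by (simp add: Zn0_def comm_group_def)
next
  case (insert j J)
  have "h (\<lambda>i. \<Sum>j\<in>insert j J. u j i) = h (u j \<otimes>\<^bsub>Zn0 n\<^esub> (\<lambda>i. \<Sum>j\<in>J. u j i))"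
    using insert.hyps by (simp add: Zn0_def)
  also have "\<dots> = h (u j) \<otimes> (\<Otimes>j\<in>J. h (u j))"
    using insert by (subst hom_mult[OF h]) (auto intro!: sum_in_Zn0)
  also have "\<dots> = (\<Otimes>j\<in>insert j J. h (u j))"
    using insert.hyps insert.prems h by (intro finprod_insert[symmetric]) (auto simp: hom_def)
  finally show ?case .
qed

text \<open>A vector with entry sum zero equals the sum of \<open>v j * unit_diff j 0\<close>, so a
  homomorphism is determined by its values on these differences. They form a labelling with value
  \<open>\<one>\<close> at vertex \<open>0\<close>.\<close>

lemma hom_Zn0_eq_evaluate:
  assumes h: "h \<in> hom (Zn0 n) G" and n: "n > 0" and v: "v \<in> carrier (Zn0 n)"
  shows "h v = evaluate n (\<lambda>i. h (unit_diff i 0)) v"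
proof -
  have "v = (\<lambda>i. \<Sum>j<n. v j * unit_diff j 0 i)"
  proof
    fix i
    have "(\<Sum>j<n. v j * unit_diff j 0 i) = (\<Sum>j<n. if j = i then v j else 0) - of_bool (i = 0) * (\<Sum>j<n. v j)"
      unfolding unit_diff_def right_diff_distrib sum_subtractf sum_distrib_left
      by (intro arg_cong2[of _ _ _ _ "(-)"] sum.cong) auto
    also have "\<dots> = v i" using v by (auto simp: Zn0_def)
    finally show "v i = (\<Sum>j<n. v j * unit_diff j 0 i)" ..
  qed
  then have "h v = h (\<lambda>i. \<Sum>j<n. v j * unit_diff j 0 i)" by simp
  also have "\<dots> = (\<Otimes>j\<in>{..<n}. h (\<lambda>i. v j * unit_diff j 0 i))"
    using n by (intro hom_Zn0_sum[OF h] scale_in_Zn0 unit_diff_in_Zn0) auto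
  also have "\<dots> = (\<Otimes>j\<in>{..<n}. h (unit_diff j 0) [^] v j)"
    using n h unit_diff_in_Zn0 by (intro finprod_cong') (auto simp: hom_Zn0_scale hom_def Pi_def)
  finally show ?thesis by (simp add: evaluate_def)
qed

text \<open>On vectors of sum zero, multiplying all labels by a common element changes nothing;
  \<open>f 0 = \<one>\<close> picks one representative. Extensionality makes the set finite and the
  correspondence with homomorphisms bijective.\<close>

definition labellings :: "nat \<Rightarrow> (nat \<Rightarrow> 'a) set" where
  "labellings n = {f \<in> {..<n} \<rightarrow>\<^sub>E carrier G. f 0 = \<one> \<and> generate G (f ` {..<n}) = carrier G}"

definition row_trivial :: "nat \<Rightarrow> (nat \<Rightarrow> 'a) \<Rightarrow> nat \<Rightarrow> (nat \<Rightarrow> nat) \<Rightarrow> bool" where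
  "row_trivial n f j d \<longleftrightarrow> (\<Otimes>k\<in>{..<n} - {j}. (f j \<otimes> inv f k) [^] d k) = \<one>"

text \<open>Read off the values on the classes of \<open>unit_diff i 0\<close>; conversely
  evaluation at \<open>f\<close> descends to the quotient because it kills every Laplacian column.
  Surjectivity matches generation, since the image of the evaluation is the subgroup generated by
  the labels.\<close>

lemma card_Sur_sandpile:
  assumes n: "n > 0"
  shows "card (Sur (sandpile n deg) G) = card {f \<in> labellings n. \<forall>j<n. row_trivial n f j (\<lambda>k. deg (j, k))}"
proof (rule bij_betw_same_card)
  let ?Z = "Zn0 n" and ?N = "lap_image n deg"
  let ?W = "{f \<in> labellings n. \<forall>j<n. row_trivial n f j (\<lambda>k. deg (j, k))}"
  interpret Z: comm_group ?Z by (rule comm_group_Zn0)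
  have Nsub: "subgroup ?N ?Z" by (rule subgroup_lap_image)
  have Nnormal: "normal ?N ?Z" using Z.subgroup_imp_normal[OF Nsub] .
  interpret N: normal ?N ?Z by (rule Nnormal)
  have quot: "carrier (sandpile n deg) = {?N #>\<^bsub>?Z\<^esub> v | v. v \<in> carrier ?Z}"
    by (auto simp: sandpile_def FactGroup_def RCOSETS_def)
  have qmult: "(?N #>\<^bsub>?Z\<^esub> v) \<otimes>\<^bsub>sandpile n deg\<^esub> (?N #>\<^bsub>?Z\<^esub> w) = ?N #>\<^bsub>?Z\<^esub> (v \<otimes>\<^bsub>?Z\<^esub> w)"
    if "v \<in> carrier ?Z" "w \<in> carrier ?Z" for v w
    using that by (simp add: sandpile_def FactGroup_def N.rcos_sum)
  define T where "T = (\<lambda>h. \<lambda>i\<in>{..<n}. h (?N #>\<^bsub>?Z\<^esub> unit_diff i 0) :: 'a)"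
  have lift: "(\<lambda>v. h (?N #>\<^bsub>?Z\<^esub> v)) \<in> hom ?Z G" if "h \<in> hom (sandpile n deg) G" for h
  proof (rule homI)
    fix v w assume vw: "v \<in> carrier ?Z" "w \<in> carrier ?Z"
    then have "?N #>\<^bsub>?Z\<^esub> v \<in> carrier (sandpile n deg)" "?N #>\<^bsub>?Z\<^esub> w \<in> carrier (sandpile n deg)"
      by (auto simp: quot)
    then show "h (?N #>\<^bsub>?Z\<^esub> (v \<otimes>\<^bsub>?Z\<^esub> w)) = h (?N #>\<^bsub>?Z\<^esub> v) \<otimes> h (?N #>\<^bsub>?Z\<^esub> w)"
      using hom_mult[OF that] qmult[OF vw] by metis
  next
    fix v assume "v \<in> carrier ?Z"
    then have "?N #>\<^bsub>?Z\<^esub> v \<in> carrier (sandpile n deg)" by (auto simp: quot)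
    then show "h (?N #>\<^bsub>?Z\<^esub> v) \<in> carrier G" using that by (auto simp: hom_def)
  qed
  have T_closed: "T h \<in> {..<n} \<rightarrow>\<^sub>E carrier G" if "h \<in> hom (sandpile n deg) G" for h
    using lift[OF that] unit_diff_in_Zn0 n by (auto simp: T_def hom_def Pi_def)
  have T_eval: "h (?N #>\<^bsub>?Z\<^esub> v) = evaluate n (T h) v"
    if "h \<in> hom (sandpile n deg) G" "v \<in> carrier ?Z" for h v
  proof -
    have "h (?N #>\<^bsub>?Z\<^esub> v) = evaluate n (\<lambda>i. h (?N #>\<^bsub>?Z\<^esub> unit_diff i 0)) v"
      by (rule hom_Zn0_eq_evaluate[OF lift[OF that(1)] n that(2)])
    also have "\<dots> = evaluate n (T h) v"
      unfolding evaluate_def using lift[OF that(1)] unit_diff_in_Zn0 n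
      by (intro finprod_cong') (auto simp: T_def hom_def Pi_def)
    finally show ?thesis .
  qed
  have trivial_iff: "row_trivial n f j (\<lambda>k. deg (j, k)) \<longleftrightarrow> evaluate n f (lap_column n deg j) = \<one>"
    if "f \<in> {..<n} \<rightarrow>\<^sub>E carrier G" "j < n" for f j
    using that evaluate_lap_column[of f n j deg] by (auto simp: row_trivial_def PiE_def)
  show "bij_betw T (Sur (sandpile n deg) G) ?W"
    unfolding bij_betw_def
  proof
    show "inj_on T (Sur (sandpile n deg) G)"
    proof (rule inj_onI)
      fix h h' assume h: "h \<in> Sur (sandpile n deg) G" and h': "h' \<in> Sur (sandpile n deg) G" and eq: "T h = T h'"
      have "h C = h' C" if C: "C \<in> carrier (sandpile n deg)" for C
      proof -
        obtain v where "v \<in> carrier ?Z" "C = ?N #>\<^bsub>?Z\<^esub> v" using C quot by auto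
        moreover have "h \<in> hom (sandpile n deg) G" "h' \<in> hom (sandpile n deg) G"
          using h h' by (auto simp: Sur_def)
        ultimately show ?thesis using T_eval[of h v] T_eval[of h' v] eq by simp
      qed
      then show "h = h'" using h h' unfolding Sur_def by (auto intro: extensionalityI)
    qed
    show "T ` Sur (sandpile n deg) G = ?W"
    proof (intro equalityI subsetI)
      fix f assume "f \<in> T ` Sur (sandpile n deg) G"
      then obtain h where hS: "h \<in> Sur (sandpile n deg) G" and f: "f = T h" by blast
      have h: "h \<in> hom (sandpile n deg) G" and surj: "h ` carrier (sandpile n deg) = carrier G"
        using hS by (auto simp: Sur_def)
      have fE: "f \<in> {..<n} \<rightarrow>\<^sub>E carrier G" using T_closed[OF h] f by simp
      then have fP: "f \<in> {..<n} \<rightarrow> carrier G" by (auto simp: PiE_def)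
      have "unit_diff 0 0 = \<one>\<^bsub>?Z\<^esub>" by (auto simp: unit_diff_def Zn0_def)
      then have f0: "f 0 = \<one>"
        using hom_one[OF lift[OF h]] n is_group Z.is_group by (simp add: f T_def)
      have "generate G (f ` {..<n}) = evaluate n f ` carrier ?Z"
        by (rule evaluate_image[OF fP n f0, symmetric])
      also have "\<dots> = h ` carrier (sandpile n deg)"
        unfolding quot using T_eval[OF h] f by (auto simp: image_iff) metis+
      finally have gen: "generate G (f ` {..<n}) = carrier G" using surj by simp
      have "row_trivial n f j (\<lambda>k. deg (j, k))" if "j < n" for j
      proof -
        have "?N #>\<^bsub>?Z\<^esub> lap_column n deg j = ?N #>\<^bsub>?Z\<^esub> \<one>\<^bsub>?Z\<^esub>"
          using lap_column_in_lap_image[OF that, of deg] Nsub Z.coset_join2[OF lap_column_in_Zn0[OF that] Nsub]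
            Z.coset_join2[OF Z.one_closed Nsub subgroup.one_closed[OF Nsub]] by simp
        then have "evaluate n f (lap_column n deg j) = \<one>"
          using T_eval[OF h lap_column_in_Zn0[OF that, of deg]]
            hom_one[OF lift[OF h]] is_group Z.is_group f by simp
        then show ?thesis using trivial_iff[OF fE that] by simp
      qed
      then show "f \<in> ?W" using fE f0 gen by (simp add: labellings_def)
    next
      fix f assume "f \<in> ?W"
      then have fE: "f \<in> {..<n} \<rightarrow>\<^sub>E carrier G" and f0: "f 0 = \<one>"
        and gen: "generate G (f ` {..<n}) = carrier G"
        and triv: "\<And>j. j < n \<Longrightarrow> evaluate n f (lap_column n deg j) = \<one>"
        using trivial_iff by (auto simp: labellings_def)
      then have fP: "f \<in> {..<n} \<rightarrow> carrier G" by (auto simp: PiE_def)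
      \<comment> \<open>The choice of representative is harmless: two of them differ by an element
        of the Laplacian image, where the evaluation is trivial.\<close>
      define h where "h = (\<lambda>C\<in>carrier (sandpile n deg). evaluate n f (SOME v. v \<in> C))"
      have h_eval: "h (?N #>\<^bsub>?Z\<^esub> v) = evaluate n f v" if v: "v \<in> carrier ?Z" for v
      proof -
        have "v \<in> ?N #>\<^bsub>?Z\<^esub> v" using Z.rcos_self[OF v Nsub] .
        then have "(SOME w. w \<in> ?N #>\<^bsub>?Z\<^esub> v) \<in> ?N #>\<^bsub>?Z\<^esub> v"
          by (rule someI[where P = "\<lambda>w. w \<in> ?N #>\<^bsub>?Z\<^esub> v"])
        then obtain m where m: "m \<in> ?N" "(SOME w. w \<in> ?N #>\<^bsub>?Z\<^esub> v) = (\<lambda>i. m i + v i)"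
          by (auto simp: r_coset_def Zn0_def)
        have "evaluate n f (\<lambda>i. m i + v i) = evaluate n f v"
          using evaluate_add[OF fP, of m v] evaluate_lap_image[OF fP m(1) triv] evaluate_closed[OF fP] by simp
        then show ?thesis using v m by (auto simp: h_def quot)
      qed
      have "h \<in> hom (sandpile n deg) G"
        unfolding hom_def
      proof (intro CollectI conjI ballI funcsetI)
        fix C assume "C \<in> carrier (sandpile n deg)"
        then show "h C \<in> carrier G" using h_eval evaluate_closed[OF fP] by (auto simp: quot)
      next
        fix C C' assume "C \<in> carrier (sandpile n deg)" "C' \<in> carrier (sandpile n deg)"
        then obtain v w where vw: "v \<in> carrier ?Z" "w \<in> carrier ?Z"
          "C = ?N #>\<^bsub>?Z\<^esub> v" "C' = ?N #>\<^bsub>?Z\<^esub> w" by (auto simp: quot)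
        have "evaluate n f (v \<otimes>\<^bsub>?Z\<^esub> w) = evaluate n f v \<otimes> evaluate n f w"
          using evaluate_add[OF fP, of v w] by (simp add: Zn0_def)
        then show "h (C \<otimes>\<^bsub>sandpile n deg\<^esub> C') = h C \<otimes> h C'"
          using vw by (simp add: qmult h_eval)
      qed
      moreover have "h ` carrier (sandpile n deg) = carrier G"
      proof -
        have "h ` carrier (sandpile n deg) = evaluate n f ` carrier ?Z"
          unfolding quot using h_eval by (auto simp: image_iff) metis+
        then show ?thesis using evaluate_image[OF fP n f0] gen by simp
      qed
      ultimately have "h \<in> Sur (sandpile n deg) G" by (auto simp: Sur_def h_def)
      moreover have "T h = f"
      proof
        fix i
        show "T h i = f i"
        proof (cases "i < n")
          case True
          then show ?thesis
            using h_eval[OF unit_diff_in_Zn0[OF True n]] evaluate_unit_diff[OF fP True n] f0 fP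
            by (auto simp: T_def Pi_def)
        next
          case False
          then show ?thesis using fE by (auto simp: T_def PiE_def extensional_def)
        qed
      qed
      ultimately show "f \<in> T ` Sur (sandpile n deg) G" by blast
    qed
  qed
qed

end

lemma (in group) proper_subgroup_card:
  assumes H: "subgroup H G" "H \<noteq> carrier G" and fin: "finite (carrier G)"
  shows "2 * card H \<le> card (carrier G)"
proof -
  have HG: "H \<subseteq> carrier G" by (rule subgroup.subset[OF H(1)])
  then have "card H < card (carrier G)" using H(2) fin by (simp add: psubset_card_mono psubset_eq)
  moreover have "card (rcosets H) * card H = card (carrier G)"
    using lagrange_finite[OF fin H(1)] by (simp add: order_def)
  ultimately have "card (rcosets H) \<noteq> 1" "card (rcosets H) \<noteq> 0" by (metis mult_1 less_irrefl, metis mult_0 not_less0)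
  then have "2 \<le> card (rcosets H)" by linarith
  then have "2 * card H \<le> card (rcosets H) * card H" by (rule mult_le_mono1)
  then show ?thesis using \<open>card (rcosets H) * card H = card (carrier G)\<close> by simp
qed

section \<open>Frequent labels\<close>

context finite_exponent_group
begin

definition row_prob :: "nat \<Rightarrow> (nat \<times> nat \<Rightarrow> nat pmf) \<Rightarrow> (nat \<Rightarrow> 'a) \<Rightarrow> nat \<Rightarrow> real" where
  "row_prob n D f j = pmf (product_law ({..<n} - {j}) (\<lambda>k. D (j, k)) (\<lambda>k. f j \<otimes> inv f k)) \<one>"

lemma finite_labellings: "finite (labellings n)"
  by (rule finite_subset[of _ "{..<n} \<rightarrow>\<^sub>E carrier G"])
    (auto simp: labellings_def intro!: finite_PiE finite_carrier)

lemma expectation_card_Sur: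
  assumes n: "n > 0"
  shows "measure_pmf.expectation (random_digraph n D) (\<lambda>deg. real (card (Sur (sandpile n deg) G))) =
    (\<Sum>f\<in>labellings n. \<Prod>j<n. row_prob n D f j)"
proof -
  let ?E = "\<lambda>f. {deg. \<forall>j<n. row_trivial n f j (\<lambda>k. deg (j, k))}"
  have "real (card (Sur (sandpile n deg) G)) = (\<Sum>f\<in>labellings n. indicator (?E f) deg)" for deg
  proof -
    have "{f \<in> labellings n. \<forall>j<n. row_trivial n f j (\<lambda>k. deg (j, k))} = {f \<in> labellings n. deg \<in> ?E f}"
      by auto
    then show ?thesis
      using finite_labellings[of n]
      by (simp add: card_Sur_sandpile[OF n] indicator_def sum.If_cases Int_def)
  qed
  then have "measure_pmf.expectation (random_digraph n D) (\<lambda>deg. real (card (Sur (sandpile n deg) G))) =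
      measure_pmf.expectation (random_digraph n D) (\<lambda>deg. \<Sum>f\<in>labellings n. indicator (?E f) deg)"
    by simp
  also have "\<dots> = (\<Sum>f\<in>labellings n. measure_pmf.prob (random_digraph n D) (?E f))"
    by (subst Bochner_Integration.integral_sum) (auto simp: measure_pmf.emeasure_eq_measure)
  also have "\<dots> = (\<Sum>f\<in>labellings n. \<Prod>j<n. row_prob n D f j)"
  proof (intro sum.cong refl)
    fix f
    have "{d. row_trivial n f j d} =
        (\<lambda>d. \<Otimes>k\<in>{..<n} - {j}. (f j \<otimes> inv f k) [^] d k) -` {\<one>}" for j
      by (auto simp: row_trivial_def)
    then have "measure_pmf.prob (Pi_pmf ({..<n} - {j}) 0 (\<lambda>k. D (j, k))) {d. row_trivial n f j d} = row_prob n D f j" for j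
      by (simp add: row_prob_def product_law_def pmf_map)
    then show "measure_pmf.prob (random_digraph n D) (?E f) = (\<Prod>j<n. row_prob n D f j)"
      using prob_random_digraph_rows[of n D "row_trivial n f"] by simp
  qed
  finally show ?thesis .
qed

definition frequent :: "real \<Rightarrow> nat \<Rightarrow> (nat \<Rightarrow> 'a) \<Rightarrow> 'a set" where
  "frequent \<delta> n f = {v \<in> carrier G. \<delta> * real n \<le> real (card {i\<in>{..<n}. f i = v})}"

text \<open>Built from quotients and not from the labels themselves, because rows see only
  quotients; the frequent labels all lie in one coset of this subgroup.\<close>

definition frequent_subgroup :: "real \<Rightarrow> nat \<Rightarrow> (nat \<Rightarrow> 'a) \<Rightarrow> 'a set" where
  "frequent_subgroup \<delta> n f = generate G {u \<otimes> inv v | u v. u \<in> frequent \<delta> n f \<and> v \<in> frequent \<delta> n f}"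

lemma frequent_subset: "frequent \<delta> n f \<subseteq> carrier G"
  by (auto simp: frequent_def)

lemma subgroup_frequent_subgroup: "subgroup (frequent_subgroup \<delta> n f) G"
  unfolding frequent_subgroup_def using frequent_subset[of \<delta> n f]
  by (intro generate_is_subgroup) auto

lemma card_infrequent_le:
  assumes f: "f \<in> {..<n} \<rightarrow> carrier G" and "\<delta> \<ge> 0"
  shows "real (card {i\<in>{..<n}. f i \<notin> frequent \<delta> n f}) \<le> real (card (carrier G)) * \<delta> * real n"
proof -
  have "{i\<in>{..<n}. f i \<notin> frequent \<delta> n f} = (\<Union>v\<in>carrier G - frequent \<delta> n f. {i\<in>{..<n}. f i = v})"
    using f by auto
  then have "card {i\<in>{..<n}. f i \<notin> frequent \<delta> n f} \<le> (\<Sum>v\<in>carrier G - frequent \<delta> n f. card {i\<in>{..<n}. f i = v})"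
    using finite_carrier by (simp add: card_UN_le)
  then have "real (card {i\<in>{..<n}. f i \<notin> frequent \<delta> n f}) \<le>
      (\<Sum>v\<in>carrier G - frequent \<delta> n f. real (card {i\<in>{..<n}. f i = v}))"
    unfolding of_nat_sum[symmetric] of_nat_le_iff .
  also have "\<dots> \<le> (\<Sum>v\<in>carrier G - frequent \<delta> n f. \<delta> * real n)"
    by (intro sum_mono) (auto simp: frequent_def)
  also have "\<dots> \<le> (\<Sum>v\<in>carrier G. \<delta> * real n)"
    using finite_carrier \<open>\<delta> \<ge> 0\<close> by (intro sum_mono2) auto
  finally show ?thesis by (simp add: mult.assoc)
qed

text \<open>A row has a fixed numerator \<open>x = f j\<close>, whereas \<open>H\<close> is
  generated by quotients of two frequent labels. If \<open>x\<close> lies in the coset of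
  \<open>y\<close>, both families generate \<open>H\<close>: \<open>x \<otimes> inv v\<close> is
  \<open>(inv y \<otimes> x) \<otimes> (y \<otimes> inv v)\<close>, and
  \<open>u \<otimes> inv v\<close> is
  \<open>inv (x \<otimes> inv u) \<otimes> (x \<otimes> inv v)\<close>.\<close>

lemma generate_translates:
  assumes C: "C \<subseteq> carrier G" and y: "y \<in> C" and x: "x \<in> carrier G"
    and H: "H = generate G {u \<otimes> inv v | u v. u \<in> C \<and> v \<in> C}" and xH: "inv y \<otimes> x \<in> H"
  shows "generate G {x \<otimes> inv v | v. v \<in> C} = H"
proof
  have sub: "{u \<otimes> inv v | u v. u \<in> C \<and> v \<in> C} \<subseteq> carrier G" using C by auto
  have Hsub: "subgroup H G" unfolding H by (rule generate_is_subgroup[OF sub])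
  have yG: "y \<in> carrier G" using y C by auto
  show "generate G {x \<otimes> inv v | v. v \<in> C} \<subseteq> H"
  proof (rule generate_subgroup_incl[OF _ Hsub], clarify)
    fix v assume v: "v \<in> C"
    then have vG: "v \<in> carrier G" using C by auto
    have "y \<otimes> inv v \<in> H" unfolding H using v y by (intro generate.incl) auto
    then have "(inv y \<otimes> x) \<otimes> (y \<otimes> inv v) \<in> H" using xH Hsub by (simp add: subgroup.m_closed)
    also have "(inv y \<otimes> x) \<otimes> (y \<otimes> inv v) = (inv y \<otimes> y) \<otimes> (x \<otimes> inv v)"
      using x yG vG m_comm[of x y] by (simp add: m_assoc m_lcomm) (simp add: m_assoc[symmetric])
    finally show "x \<otimes> inv v \<in> H" using x yG vG by simp
  qed
  have sub': "{x \<otimes> inv v | v. v \<in> C} \<subseteq> carrier G" using C x by auto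
  have sub'': "subgroup (generate G {x \<otimes> inv v | v. v \<in> C}) G" by (rule generate_is_subgroup[OF sub'])
  show "H \<subseteq> generate G {x \<otimes> inv v | v. v \<in> C}"
    unfolding H
  proof (rule generate_subgroup_incl[OF _ sub''], clarify)
    fix u v assume uv: "u \<in> C" "v \<in> C"
    then have G: "u \<in> carrier G" "v \<in> carrier G" using C by auto
    have "x \<otimes> inv u \<in> generate G {x \<otimes> inv v | v. v \<in> C}" "x \<otimes> inv v \<in> generate G {x \<otimes> inv v | v. v \<in> C}"
      using uv by (auto intro: generate.incl)
    then have "inv (x \<otimes> inv u) \<otimes> (x \<otimes> inv v) \<in> generate G {x \<otimes> inv v | v. v \<in> C}"
      using sub'' by (simp add: subgroup.m_closed subgroup.m_inv_closed)
    also have "inv (x \<otimes> inv u) \<otimes> (x \<otimes> inv v) = u \<otimes> inv v"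
      using x G by (simp add: inv_mult_group m_assoc) (simp add: m_assoc[symmetric])
    finally show "u \<otimes> inv v \<in> generate G {x \<otimes> inv v | v. v \<in> C}" .
  qed
qed

text \<open>The Fourier bound is applied to the quotients of \<open>f j\<close> by frequent labels.
  The exponent drops by one because vertex \<open>j\<close> may carry a frequent label itself and is
  not a factor of its own row. The constants are fixed before \<delta> and \<open>n\<close>.\<close>

lemma row_prob_near_average:
  assumes eps: "eps > 0"
  shows "\<exists>\<rho> M. 0 < \<rho> \<and> \<rho> < 1 \<and> M > 0 \<and> (\<forall>\<delta> n D f y j. balanced_digraph eps n D \<longrightarrow>
    f \<in> {..<n} \<rightarrow> carrier G \<longrightarrow> j < n \<longrightarrow> y \<in> frequent \<delta> n f \<longrightarrow> inv y \<otimes> f j \<in> frequent_subgroup \<delta> n f \<longrightarrow>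
     \<bar>row_prob n D f j - (\<Sum>h\<in>frequent_subgroup \<delta> n f.
         pmf (product_law ({..<n} - {j}) (\<lambda>k. D (j, k)) (\<lambda>k. f j \<otimes> inv f k)) h) / card (frequent_subgroup \<delta> n f)\<bar>
       \<le> M * \<rho> ^ (nat \<lfloor>\<delta> * real n\<rfloor> - 1))"
proof -
  obtain \<rho> M where *: "0 < \<rho> \<and> \<rho> < 1 \<and> M > 0 \<and> (\<forall>(A :: nat set) p g S N. finite A \<longrightarrow> g \<in> A \<rightarrow> carrier G \<longrightarrow>
     (\<forall>k\<in>A. balanced_rv eps (p k)) \<longrightarrow> S \<subseteq> carrier G \<longrightarrow> (\<forall>s\<in>S. N \<le> card {k\<in>A. g k = s}) \<longrightarrow>
     \<bar>pmf (product_law A p g) \<one> - (\<Sum>h\<in>generate G S. pmf (product_law A p g) h) / card (generate G S)\<bar>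
       \<le> M * \<rho> ^ N)"
    using product_law_near_average[OF eps, where 'k = nat] by (elim exE)
  then have \<rho>: "0 < \<rho>" "\<rho> < 1" and M: "M > 0" by blast+
  note main = *[THEN conjunct2, THEN conjunct2, THEN conjunct2, rule_format]
  have "\<bar>row_prob n D f j - (\<Sum>h\<in>frequent_subgroup \<delta> n f.
         pmf (product_law ({..<n} - {j}) (\<lambda>k. D (j, k)) (\<lambda>k. f j \<otimes> inv f k)) h) / card (frequent_subgroup \<delta> n f)\<bar>
       \<le> M * \<rho> ^ (nat \<lfloor>\<delta> * real n\<rfloor> - 1)"
    if bal: "balanced_digraph eps n D" and f: "f \<in> {..<n} \<rightarrow> carrier G" and j: "j < n"
      and y: "y \<in> frequent \<delta> n f" and yj: "inv y \<otimes> f j \<in> frequent_subgroup \<delta> n f" for \<delta> n D f y j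
  proof -
    define S where "S = {f j \<otimes> inv v | v. v \<in> frequent \<delta> n f}"
    have fj: "f j \<in> carrier G" using f j by auto
    have gen: "generate G S = frequent_subgroup \<delta> n f"
      unfolding S_def
      by (rule generate_translates[OF frequent_subset y fj frequent_subgroup_def yj])
    have count: "nat \<lfloor>\<delta> * real n\<rfloor> - 1 \<le> card {k\<in>{..<n} - {j}. f j \<otimes> inv f k = s}" if s: "s \<in> S" for s
    proof -
      obtain v where v: "v \<in> frequent \<delta> n f" "s = f j \<otimes> inv v" using s S_def by auto
      have "{k\<in>{..<n}. f k = v} - {j} \<subseteq> {k\<in>{..<n} - {j}. f j \<otimes> inv f k = s}"
        using v by auto
      then have "card ({k\<in>{..<n}. f k = v} - {j}) \<le> card {k\<in>{..<n} - {j}. f j \<otimes> inv f k = s}"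
        by (intro card_mono) auto
      moreover have "card {k\<in>{..<n}. f k = v} - 1 \<le> card ({k\<in>{..<n}. f k = v} - {j})"
        by (simp add: card_Diff_singleton_if)
      moreover have "nat \<lfloor>\<delta> * real n\<rfloor> \<le> card {k\<in>{..<n}. f k = v}"
        using v(1) unfolding frequent_def by (auto simp: nat_le_iff floor_le_iff)
      ultimately show ?thesis by linarith
    qed
    have "\<forall>k\<in>{..<n} - {j}. balanced_rv eps (D (j, k))"
      using bal j by (auto simp: balanced_digraph_def offdiag_def)
    then have "\<bar>pmf (product_law ({..<n} - {j}) (\<lambda>k. D (j, k)) (\<lambda>k. f j \<otimes> inv f k)) \<one> -
        (\<Sum>h\<in>generate G S. pmf (product_law ({..<n} - {j}) (\<lambda>k. D (j, k)) (\<lambda>k. f j \<otimes> inv f k)) h) / card (generate G S)\<bar>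
       \<le> M * \<rho> ^ (nat \<lfloor>\<delta> * real n\<rfloor> - 1)"
      using f fj frequent_subset[of \<delta> n f] count by (intro main) (auto simp: S_def Pi_def)
    then show ?thesis unfolding gen row_prob_def .
  qed
  then show ?thesis by (intro exI[of _ \<rho>] exI[of _ M] conjI allI impI \<rho> M)
qed

lemma row_prob_nonneg: "row_prob n D f j \<ge> 0" and row_prob_le_1: "row_prob n D f j \<le> 1"
  by (simp_all add: row_prob_def pmf_le_1)

text \<open>With \<open>f j\<close> inside the coset and \<open>f i\<close> outside, the quotient
  \<open>f j \<otimes> inv f i\<close> is a factor of row \<open>j\<close> outside
  \<open>H\<close>.\<close>

lemma sum_row_law_coset_le:
  assumes bal: "balanced_digraph eps n D" and f: "f \<in> {..<n} \<rightarrow> carrier G" and j: "j < n" and i: "i < n"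
    and H: "subgroup H G" and y: "y \<in> carrier G" and yj: "inv y \<otimes> f j \<in> H" and yi: "inv y \<otimes> f i \<notin> H"
  shows "(\<Sum>h\<in>H. pmf (product_law ({..<n} - {j}) (\<lambda>k. D (j, k)) (\<lambda>k. f j \<otimes> inv f k)) h) \<le> 1 - eps"
proof -
  have fG: "f j \<in> carrier G" "f i \<in> carrier G" using f i j by auto
  have "f j \<otimes> inv f i \<notin> H"
  proof
    assume "f j \<otimes> inv f i \<in> H"
    then have "(inv y \<otimes> f j) \<otimes> inv (f j \<otimes> inv f i) \<in> H"
      using yj H by (simp add: subgroup.m_closed subgroup.m_inv_closed)
    also have "(inv y \<otimes> f j) \<otimes> inv (f j \<otimes> inv f i) = inv y \<otimes> f i"
      using fG y m_comm[of "f i" "inv f j"] by (simp add: inv_mult_group m_assoc) (simp add: m_assoc[symmetric])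
    finally show False using yi by simp
  qed
  moreover have "i \<noteq> j" using yi yj by auto
  ultimately have "(\<Sum>h\<in>H. pmf (product_law ({..<n} - {j}) (\<lambda>k. D (j, k)) (\<lambda>k. f j \<otimes> inv f k)) (\<one> \<otimes> h)) \<le> 1 - eps"
    using bal f fG i j
    by (intro product_law_coset_le[OF H]) (auto simp: balanced_digraph_def offdiag_def Pi_def)
  moreover have "H \<subseteq> carrier G" by (rule subgroup.subset[OF H])
  ultimately show ?thesis by (simp add: subset_iff)
qed

end

section \<open>Summation of the row estimates over all labellings\<close>

lemma prod_near_one:
  fixes b :: "'i \<Rightarrow> real"
  assumes "finite J" "u \<ge> 0" "\<And>j. j \<in> J \<Longrightarrow> \<bar>b j - 1\<bar> \<le> u"
  shows "\<bar>(\<Prod>j\<in>J. b j) - 1\<bar> \<le> (1 + u) ^ card J - 1"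
  using assms(1,3)
proof induction
  case (insert j J)
  let ?P = "\<Prod>j\<in>J. b j"
  have bj: "\<bar>b j - 1\<bar> \<le> u" using insert by auto
  then have "\<bar>b j\<bar> \<le> 1 + u" by linarith
  moreover have "\<bar>?P - 1\<bar> \<le> (1 + u) ^ card J - 1" using insert by auto
  ultimately have "\<bar>b j\<bar> * \<bar>?P - 1\<bar> \<le> (1 + u) * ((1 + u) ^ card J - 1)"
    using \<open>u \<ge> 0\<close> by (intro mult_mono) auto
  moreover have "b j * ?P - 1 = b j * (?P - 1) + (b j - 1)" by (simp add: algebra_simps)
  ultimately have "\<bar>b j * ?P - 1\<bar> \<le> (1 + u) * ((1 + u) ^ card J - 1) + u"
    using bj abs_triangle_ineq[of "b j * (?P - 1)" "b j - 1"] by (simp add: abs_mult)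
  then show ?case using insert.hyps by (simp add: algebra_simps)
qed simp

context finite_exponent_group
begin

text \<open>Charging \<open>c\<close> for a label in the coset and a tiny \<open>x\<close> for an exceptional one makes the sum over all
  labellings factorise; undoing the charge for at most \<open>\<alpha> n\<close> exceptional vertices costs \<open>x powr (- \<alpha> n)\<close>.\<close>
definition coset_weight :: "real \<Rightarrow> real \<Rightarrow> 'a set \<Rightarrow> 'a \<Rightarrow> 'a \<Rightarrow> real" where
  "coset_weight c x H y v = (if inv y \<otimes> v \<in> H then c else x)"

lemma sum_coset_weight_le:
  assumes H: "H \<subseteq> carrier G" and y: "y \<in> carrier G" and x: "x \<ge> 0"
  shows "(\<Sum>v\<in>carrier G. coset_weight c x H y v) \<le> real (card H) * c + real (card (carrier G)) * x"
proof -
  have "bij_betw (\<lambda>h. y \<otimes> h) H {v\<in>carrier G. inv y \<otimes> v \<in> H}"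
    using H y by (intro bij_betw_byWitness[where f' = "\<lambda>v. inv y \<otimes> v"])
      (auto simp: m_assoc[symmetric] subset_iff)
  then have card: "card {v\<in>carrier G. inv y \<otimes> v \<in> H} = card H" by (metis bij_betw_same_card)
  have "(\<Sum>v\<in>carrier G. coset_weight c x H y v) =
      (\<Sum>v\<in>{v\<in>carrier G. inv y \<otimes> v \<in> H}. c) + (\<Sum>v\<in>{v\<in>carrier G. inv y \<otimes> v \<notin> H}. x)"
    using finite_carrier by (simp add: coset_weight_def sum.If_cases Int_def Compl_eq)
  also have "\<dots> \<le> real (card H) * c + real (card (carrier G)) * x"
    using x finite_carrier card by (auto intro!: mult_right_mono card_mono)
  finally show ?thesis .
qed

lemma prod_coset_weight:
  "(\<Prod>i<n. coset_weight c x H y (f i)) =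
     c ^ (n - card {i\<in>{..<n}. inv y \<otimes> f i \<notin> H}) * x ^ card {i\<in>{..<n}. inv y \<otimes> f i \<notin> H}"
proof -
  have "card {i\<in>{..<n}. inv y \<otimes> f i \<in> H} = card ({..<n} - {i\<in>{..<n}. inv y \<otimes> f i \<notin> H})"
    by (rule arg_cong[of _ _ card]) auto
  also have "\<dots> = n - card {i\<in>{..<n}. inv y \<otimes> f i \<notin> H}"
    by (subst card_Diff_subset) auto
  finally show ?thesis
    by (simp add: coset_weight_def prod.If_cases Int_def Compl_eq)
qed

text \<open>At most \<open>card (carrier G)\<close> labels are infrequent, each on fewer than
  \<open>\<delta> * n\<close> vertices, so with this \<delta> they cover at most
  \<open>\<alpha> * n < n\<close> vertices. Some label \<open>y\<close> is therefore frequent, and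
  all frequent labels lie in its coset.\<close>

lemma frequent_coset:
  assumes f: "f \<in> {..<n} \<rightarrow> carrier G" and n: "n > 0"
    and \<alpha>: "0 < \<alpha>" "\<alpha> < 1" and \<delta>: "\<delta> = \<alpha> / card (carrier G)"
  obtains y where "y \<in> frequent \<delta> n f"
    and "real (card {i\<in>{..<n}. inv y \<otimes> f i \<notin> frequent_subgroup \<delta> n f}) \<le> \<alpha> * real n"
proof -
  let ?I = "{i\<in>{..<n}. f i \<notin> frequent \<delta> n f}"
  have g: "card (carrier G) > 0" using finite_carrier by (auto simp: card_gt_0_iff)
  have le: "real (card ?I) \<le> \<alpha> * real n"
    using card_infrequent_le[OF f, of \<delta>] \<alpha> g by (simp add: \<delta>)
  have "\<exists>i<n. f i \<in> frequent \<delta> n f"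
  proof (rule ccontr)
    assume "\<not> ?thesis"
    then have "?I = {..<n}" by auto
    then have "real n \<le> \<alpha> * real n" using le by simp
    then show False using \<alpha> n by simp
  qed
  then obtain y where y: "y \<in> frequent \<delta> n f" by blast
  have "{i\<in>{..<n}. inv y \<otimes> f i \<notin> frequent_subgroup \<delta> n f} \<subseteq> ?I"
  proof (intro subsetI, rule ccontr)
    fix i assume "i \<in> {i\<in>{..<n}. inv y \<otimes> f i \<notin> frequent_subgroup \<delta> n f}" "i \<notin> ?I"
    then have i: "i < n" "f i \<in> frequent \<delta> n f" "inv y \<otimes> f i \<notin> frequent_subgroup \<delta> n f" by auto
    have "f i \<otimes> inv y \<in> frequent_subgroup \<delta> n f"
      unfolding frequent_subgroup_def using i y by (intro generate.incl) auto
    moreover have "f i \<otimes> inv y = inv y \<otimes> f i"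
      using i y frequent_subset[of \<delta> n f] by (intro m_comm) auto
    ultimately show False using i by simp
  qed
  then have "card {i\<in>{..<n}. inv y \<otimes> f i \<notin> frequent_subgroup \<delta> n f} \<le> card ?I"
    by (intro card_mono) auto
  then show thesis using that[OF y] le by linarith
qed

text \<open>Shows that a normalised labelling with full frequent subgroup satisfies the generation
  condition and really is counted.\<close>

lemma generate_image_of_frequent:
  assumes f: "f \<in> {..<n} \<rightarrow> carrier G" and n: "n > 0" and \<delta>: "\<delta> > 0"
    and H: "frequent_subgroup \<delta> n f = carrier G"
  shows "generate G (f ` {..<n}) = carrier G"
proof
  have fG: "f ` {..<n} \<subseteq> carrier G" using f by auto
  show "generate G (f ` {..<n}) \<subseteq> carrier G" using generate_incl[OF fG] .
  have sub: "subgroup (generate G (f ` {..<n})) G" by (rule generate_is_subgroup[OF fG])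
  have mem: "v \<in> generate G (f ` {..<n})" if "v \<in> frequent \<delta> n f" for v
  proof -
    have "0 < \<delta> * real n" using n \<delta> by simp
    moreover have "\<delta> * real n \<le> real (card {i\<in>{..<n}. f i = v})" using that by (simp add: frequent_def)
    ultimately have "card {i\<in>{..<n}. f i = v} > 0" by linarith
    then obtain i where "i < n" "f i = v" unfolding card_gt_0_iff by blast
    then show ?thesis by (intro generate.incl) auto
  qed
  show "carrier G \<subseteq> generate G (f ` {..<n})"
    unfolding H[symmetric] frequent_subgroup_def
    using mem sub by (intro generate_subgroup_incl) (auto simp: subgroup.m_closed subgroup.m_inv_closed)
qed

text \<open>The first error term comes from labellings whose frequent subgroup is all of
  \<open>G\<close>, the second from the degenerate ones. The bound on \<tau> makes
  \<open>(1 - e) / card H + \<tau>\<close> at most \<open>(1 - e / 2) / card H\<close>. The value of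
  \<open>x\<close> makes the weights at one vertex sum to at most
  \<open>card H * c H + g * x = 1 - e / 4\<close>. The condition on \<alpha> makes the cost
  \<open>x powr (- \<alpha> * n)\<close> the inverse square root of
  \<open>(1 - e / 4) ^ n\<close>.\<close>

lemma expectation_error_bound:
  fixes \<tau> \<alpha> e x :: real and n :: nat
  defines "g \<equiv> real (card (carrier G))"
  defines "\<delta> \<equiv> \<alpha> / g"
  assumes n: "n > 0" and e: "0 < e" "e \<le> 1/2" and x: "x = e / (4 * g)"
    and \<alpha>: "0 < \<alpha>" "\<alpha> < 1" "x powr \<alpha> = sqrt (1 - e / 4)"
    and bal: "balanced_digraph e n D"
    and near: "\<And>f y j. f \<in> {..<n} \<rightarrow> carrier G \<Longrightarrow> j < n \<Longrightarrow> y \<in> frequent \<delta> n f \<Longrightarrow> inv y \<otimes> f j \<in> frequent_subgroup \<delta> n f \<Longrightarrow>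
     \<bar>row_prob n D f j - (\<Sum>h\<in>frequent_subgroup \<delta> n f.
         pmf (product_law ({..<n} - {j}) (\<lambda>k. D (j, k)) (\<lambda>k. f j \<otimes> inv f k)) h) / card (frequent_subgroup \<delta> n f)\<bar> \<le> \<tau>"
    and \<tau>: "0 \<le> \<tau>" "\<tau> \<le> e / (2 * g)"
  shows "\<bar>(\<Sum>f\<in>labellings n. \<Prod>j<n. row_prob n D f j) - 1 / g\<bar>
     \<le> ((1 + g * \<tau>) ^ n - 1) + 2 ^ card (carrier G) * g * sqrt (1 - e / 4) ^ n"
proof -
  have card_pos: "card (carrier G) > 0" using finite_carrier by (auto simp: card_gt_0_iff)
  then have g: "g \<ge> 1" unfolding g_def by simp
  have \<delta>: "\<delta> > 0" using \<alpha> g by (simp add: \<delta>_def)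
  have x01: "0 < x" "x \<le> 1" using e g by (auto simp: x field_simps)
  \<comment> \<open>Summing over all pairs of a proper subgroup and a coset representative dominates
    whichever pair a labelling determines; the overcount is only the constant
    \<open>2 ^ card (carrier G) * g\<close>.\<close>
  define J where "J = {H. subgroup H G \<and> H \<noteq> carrier G} \<times> carrier G"
  have Jsub: "J \<subseteq> Pow (carrier G) \<times> carrier G" using subgroup.subset by (auto simp: J_def)
  have finJ: "finite J" using finite_subset[OF Jsub] finite_carrier by auto
  have "card J \<le> card (Pow (carrier G) \<times> carrier G)" using Jsub finite_carrier by (intro card_mono) auto
  then have "real (card J) \<le> real (card (Pow (carrier G) \<times> carrier G))" by (simp only: of_nat_le_iff)
  then have cardJ: "real (card J) \<le> 2 ^ card (carrier G) * g"
    unfolding g_def using finite_carrier by (simp add: card_cartesian_product card_Pow)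
  \<comment> \<open>This \<open>c H\<close> bounds both the row probabilities and, as \<open>card H \<le> g / 2\<close>, the uniform weight \<open>1 / g\<close>,
    so that \<open>B f\<close> controls the two contributions of a degenerate labelling at once.\<close>
  define c where "c H = (1 - e / 2) / real (card H)" for H :: "'a set"
  define B where "B f = (\<Sum>(H, y)\<in>J. x powr (- \<alpha> * real n) * (\<Prod>i<n. coset_weight (c H) x H y (f i)))" for f
  have c_nonneg: "c H \<ge> 0" for H using e by (simp add: c_def)
  have c_le1: "c H \<le> 1" for H
    using e by (cases "card H = 0") (auto simp: c_def field_simps)
  have w_nonneg: "coset_weight (c H) x H y v \<ge> 0" for H y v
    using c_nonneg x01 by (simp add: coset_weight_def)
  have B_nonneg: "B f \<ge> 0" for f
    unfolding B_def by (intro sum_nonneg) (auto intro!: mult_nonneg_nonneg prod_nonneg w_nonneg)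
  have B_ge: "c H ^ (n - card {i\<in>{..<n}. inv y \<otimes> f i \<notin> H}) \<le> B f"
    if HJ: "(H, y) \<in> J" and s: "real (card {i\<in>{..<n}. inv y \<otimes> f i \<notin> H}) \<le> \<alpha> * real n" for H y f
  proof -
    let ?s = "card {i\<in>{..<n}. inv y \<otimes> f i \<notin> H}"
    have "1 = x powr (- \<alpha> * real n) * x powr (\<alpha> * real n)"
      using x01 by (simp add: powr_add[symmetric])
    also have "\<dots> \<le> x powr (- \<alpha> * real n) * x ^ ?s"
      using x01 s by (intro mult_left_mono) (auto simp: powr_realpow[symmetric] intro!: powr_mono')
    finally have "c H ^ (n - ?s) * 1 \<le> c H ^ (n - ?s) * (x powr (- \<alpha> * real n) * x ^ ?s)"
      using c_nonneg by (intro mult_left_mono) auto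
    then have "c H ^ (n - ?s) \<le> x powr (- \<alpha> * real n) * (\<Prod>i<n. coset_weight (c H) x H y (f i))"
      unfolding prod_coset_weight by (simp add: mult_ac)
    also have "\<dots> = (\<lambda>(H, y). x powr (- \<alpha> * real n) * (\<Prod>i<n. coset_weight (c H) x H y (f i))) (H, y)" by simp
    also have "\<dots> \<le> B f"
      unfolding B_def using HJ finJ
      by (intro member_le_sum) (auto intro!: mult_nonneg_nonneg prod_nonneg w_nonneg)
    finally show ?thesis .
  qed
  have sum_B: "(\<Sum>f\<in>{..<n} \<rightarrow>\<^sub>E carrier G. B f) \<le> 2 ^ card (carrier G) * g * sqrt (1 - e / 4) ^ n"
  proof -
    have "(\<Sum>f\<in>{..<n} \<rightarrow>\<^sub>E carrier G. B f) = (\<Sum>(H, y)\<in>J. \<Sum>f\<in>{..<n} \<rightarrow>\<^sub>E carrier G.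
        x powr (- \<alpha> * real n) * (\<Prod>i<n. coset_weight (c H) x H y (f i)))"
      unfolding B_def by (subst sum.swap) (simp add: case_prod_unfold)
    also have "\<dots> = (\<Sum>(H, y)\<in>J. x powr (- \<alpha> * real n) * (\<Sum>v\<in>carrier G. coset_weight (c H) x H y v) ^ n)"
    proof (intro sum.cong refl, clarify)
      fix H y
      have "(\<Prod>i<n. \<Sum>v\<in>carrier G. coset_weight (c H) x H y v) =
          (\<Sum>f\<in>{..<n} \<rightarrow>\<^sub>E carrier G. \<Prod>i<n. coset_weight (c H) x H y (f i))"
        using finite_carrier by (intro prod_sum_PiE) auto
      then show "(\<Sum>f\<in>{..<n} \<rightarrow>\<^sub>E carrier G. x powr (- \<alpha> * real n) * (\<Prod>i<n. coset_weight (c H) x H y (f i))) =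
          x powr (- \<alpha> * real n) * (\<Sum>v\<in>carrier G. coset_weight (c H) x H y v) ^ n"
        by (simp add: sum_distrib_left)
    qed
    also have "\<dots> \<le> (\<Sum>(H, y)\<in>J. sqrt (1 - e / 4) ^ n)"
    proof (intro sum_mono, clarify)
      fix H y assume "(H, y) \<in> J"
      then have H: "subgroup H G" and y: "y \<in> carrier G" by (auto simp: J_def)
      have HG: "H \<subseteq> carrier G" by (rule subgroup.subset[OF H])
      have "card H > 0" using H HG finite_carrier by (metis card_gt_0_iff finite_subset subgroup.one_closed empty_iff)
      have x_powr: "x powr (- \<alpha> * real n) = inverse (sqrt (1 - e / 4) ^ n)"
      proof -
        have "x powr (- \<alpha> * real n) = inverse (x powr (\<alpha> * real n))" by (simp add: powr_minus)
        also have "x powr (\<alpha> * real n) = (x powr \<alpha>) ^ n"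
          using x01 by (simp add: powr_powr[symmetric] powr_realpow)
        finally show ?thesis using \<alpha>(3) by simp
      qed
      have "(\<Sum>v\<in>carrier G. coset_weight (c H) x H y v) \<le> real (card H) * c H + g * x"
        unfolding g_def using x01 by (intro sum_coset_weight_le[OF HG y]) auto
      also have "\<dots> = 1 - e / 4" using \<open>card H > 0\<close> g by (simp add: c_def x field_simps)
      finally have "(\<Sum>v\<in>carrier G. coset_weight (c H) x H y v) ^ n \<le> (1 - e / 4) ^ n"
        by (intro power_mono sum_nonneg w_nonneg)
      then have "x powr (- \<alpha> * real n) * (\<Sum>v\<in>carrier G. coset_weight (c H) x H y v) ^ n \<le>
          x powr (- \<alpha> * real n) * (1 - e / 4) ^ n"
        by (intro mult_left_mono) auto
      also have "\<dots> = sqrt (1 - e / 4) ^ n"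
      proof -
        have "(1 - e / 4) ^ n = sqrt (1 - e / 4) ^ n * sqrt (1 - e / 4) ^ n"
          using e by (simp add: power_mult_distrib[symmetric])
        moreover have "sqrt (1 - e / 4) ^ n \<noteq> 0" using e by simp
        ultimately show ?thesis unfolding x_powr by (metis left_inverse mult.assoc mult_1)
      qed
      finally show "x powr (- \<alpha> * real n) * (\<Sum>v\<in>carrier G. coset_weight (c H) x H y v) ^ n \<le> sqrt (1 - e / 4) ^ n" .
    qed
    also have "\<dots> = real (card J) * sqrt (1 - e / 4) ^ n" by (simp add: case_prod_unfold)
    also have "\<dots> \<le> 2 ^ card (carrier G) * g * sqrt (1 - e / 4) ^ n"
      using cardJ e by (intro mult_right_mono) auto
    finally show ?thesis .
  qed
  \<comment> \<open>Without the generation condition the count is exactly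
    \<open>g ^ (n - 1)\<close>, so the comparison values \<open>(1 / g) ^ n\<close> add up to
    exactly \<open>1 / g\<close>.\<close>
  define base where "base = {f \<in> {..<n} \<rightarrow>\<^sub>E carrier G. f 0 = \<one>}"
  have fin_PiE: "finite ({..<n} \<rightarrow>\<^sub>E carrier G)" using finite_carrier by (intro finite_PiE) auto
  have base_sub: "base \<subseteq> {..<n} \<rightarrow>\<^sub>E carrier G" by (auto simp: base_def)
  have fin_base: "finite base" using finite_subset[OF base_sub fin_PiE] .
  have card_base: "real (card base) = g ^ n / g"
  proof -
    obtain m where m: "n = Suc m" using n by (cases n) auto
    have "base = PiE {..<n} (\<lambda>i. if i = 0 then {\<one>} else carrier G)"
    proof (intro equalityI subsetI)
      fix f assume "f \<in> base"
      then have "f \<in> {..<n} \<rightarrow>\<^sub>E carrier G" "f 0 = \<one>" by (auto simp: base_def)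
      then show "f \<in> PiE {..<n} (\<lambda>i. if i = 0 then {\<one>} else carrier G)"
        by (intro PiE_I) (auto dest: PiE_mem PiE_arb)
    next
      fix f assume f: "f \<in> PiE {..<n} (\<lambda>i. if i = 0 then {\<one>} else carrier G)"
      have 0: "f 0 = \<one>" using PiE_mem[OF f, of 0] n by simp
      have "f i \<in> carrier G" if "i < n" for i
        using PiE_mem[OF f, of i] that 0 by (cases "i = 0") auto
      then show "f \<in> base"
        unfolding base_def using 0 PiE_arb[OF f] by (intro CollectI conjI PiE_I) auto
    qed
    then have "card base = (\<Prod>i<n. card (if i = 0 then {\<one>} else carrier G))"
      by (simp add: card_PiE)
    also have "\<dots> = card (carrier G) ^ m"
      unfolding m by (subst prod.lessThan_Suc_shift) simp
    finally show ?thesis using g by (simp add: m g_def)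
  qed
  define P where "P f = (\<Prod>j<n. row_prob n D f j)" for f
  \<comment> \<open>For a nongenerating \<open>f\<close> the error is the whole comparison value,
    which \<open>B f\<close> has to absorb.\<close>
  define t where "t f = (if f \<in> labellings n then P f else 0) - (1 / g) ^ n" for f
  have P_nonneg: "P f \<ge> 0" for f unfolding P_def by (intro prod_nonneg) (simp add: row_prob_nonneg)
  have t_le: "\<bar>t f\<bar> \<le> (1 / g) ^ n * ((1 + g * \<tau>) ^ n - 1) + B f" if fb: "f \<in> base" for f
  proof -
    have f: "f \<in> {..<n} \<rightarrow> carrier G" and fE: "f \<in> {..<n} \<rightarrow>\<^sub>E carrier G" and f0: "f 0 = \<one>"
      using fb by (auto simp: base_def PiE_def)
    obtain y where y: "y \<in> frequent \<delta> n f"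
      and s: "real (card {i\<in>{..<n}. inv y \<otimes> f i \<notin> frequent_subgroup \<delta> n f}) \<le> \<alpha> * real n"
      using frequent_coset[OF f n \<alpha>(1,2), of \<delta>] by (auto simp: \<delta>_def g_def)
    have yG: "y \<in> carrier G" using y frequent_subset by blast
    define H where "H = frequent_subgroup \<delta> n f"
    have H: "subgroup H G" unfolding H_def by (rule subgroup_frequent_subgroup)
    have HG: "H \<subseteq> carrier G" by (rule subgroup.subset[OF H])
    have cH: "card H > 0" using H HG finite_carrier by (metis card_gt_0_iff finite_subset subgroup.one_closed empty_iff)
    show ?thesis
    proof (cases "H = carrier G")
      case True
      then have lab: "f \<in> labellings n"
        using generate_image_of_frequent[OF f n \<delta>] fE f0 by (simp add: labellings_def H_def)
      have "\<bar>g * row_prob n D f j - 1\<bar> \<le> g * \<tau>" if j: "j < n" for j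
      proof -
        have fj: "f j \<in> carrier G" using f j by auto
        have "(\<Sum>h\<in>H. pmf (product_law ({..<n} - {j}) (\<lambda>k. D (j, k)) (\<lambda>k. f j \<otimes> inv f k)) h) = 1"
          unfolding True using f fj by (intro sum_product_law) (auto simp: Pi_def)
        moreover have "inv y \<otimes> f j \<in> H" using True yG fj by simp
        ultimately have "\<bar>row_prob n D f j - 1 / g\<bar> \<le> \<tau>"
          using near[OF f j y] True by (simp add: H_def g_def)
        then have "g * \<bar>row_prob n D f j - 1 / g\<bar> \<le> g * \<tau>" using g by simp
        moreover have "g * \<bar>row_prob n D f j - 1 / g\<bar> = \<bar>g * row_prob n D f j - 1\<bar>"
        proof -
          have "g * row_prob n D f j - 1 = g * (row_prob n D f j - 1 / g)"
            using g by (simp add: right_diff_distrib)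
          then have "\<bar>g * row_prob n D f j - 1\<bar> = \<bar>g\<bar> * \<bar>row_prob n D f j - 1 / g\<bar>"
            by (simp only: abs_mult)
          then show ?thesis using g by simp
        qed
        ultimately show ?thesis by simp
      qed
      then have "\<bar>(\<Prod>j<n. g * row_prob n D f j) - 1\<bar> \<le> (1 + g * \<tau>) ^ card {..<n} - 1"
        using g \<tau> by (intro prod_near_one) auto
      then have "(1 / g) ^ n * \<bar>g ^ n * P f - 1\<bar> \<le> (1 / g) ^ n * ((1 + g * \<tau>) ^ n - 1)"
        using g by (intro mult_left_mono) (auto simp: P_def prod.distrib)
      moreover have "(1 / g) ^ n * \<bar>g ^ n * P f - 1\<bar> = \<bar>t f\<bar>"
      proof -
        have "(1 / g) ^ n * \<bar>g ^ n * P f - 1\<bar> = \<bar>(1 / g) ^ n * (g ^ n * P f - 1)\<bar>"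
          using g by (simp add: abs_mult)
        also have "(1 / g) ^ n * (g ^ n * P f - 1) = t f"
          using g lab by (simp add: t_def field_simps)
        finally show ?thesis .
      qed
      ultimately show ?thesis using B_nonneg[of f] by linarith
    next
      case False
      have HJ: "(H, y) \<in> J" using H False yG by (simp add: J_def)
      let ?s = "{i\<in>{..<n}. inv y \<otimes> f i \<notin> H}"
      have Bs: "c H ^ (n - card ?s) \<le> B f" using B_ge[OF HJ] s by (simp add: H_def)
      have two: "2 * real (card H) \<le> g"
        unfolding g_def using proper_subgroup_card[OF H False finite_carrier] by linarith
      have "1 / g \<le> c H"
      proof -
        have "1 / g \<le> (1/2) / real (card H)" using two cH g by (simp add: field_simps)
        also have "\<dots> \<le> c H" unfolding c_def using e by (intro divide_right_mono) auto
        finally show ?thesis .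
      qed
      then have "(1 / g) ^ n \<le> c H ^ n" using g by (intro power_mono) auto
      also have "\<dots> \<le> c H ^ (n - card ?s)" using c_nonneg c_le1 by (intro power_decreasing) auto
      finally have 1: "(1 / g) ^ n \<le> B f" using Bs by linarith
      have 2: "P f \<le> B f" if lab: "f \<in> labellings n"
      proof -
        \<comment> \<open>Without exceptional vertices \<open>f 0 = \<one>\<close> would make the
          coset equal to \<open>H\<close>, so all labels would lie in \<open>H\<close> and could not
          generate \<open>G\<close>.\<close>
        have "?s \<noteq> {}"
        proof
          assume empty: "?s = {}"
          then have all: "inv y \<otimes> f i \<in> H" if "i < n" for i using that by auto
          have "f i \<in> H" if i: "i < n" for i
          proof -
            have "inv (inv y \<otimes> f 0) \<otimes> (inv y \<otimes> f i) \<in> H"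
              using all[OF i] all[OF n] H by (simp add: subgroup.m_closed subgroup.m_inv_closed)
            moreover have "f i \<in> carrier G" using f i by auto
            ultimately show ?thesis using f0 yG by (simp add: m_assoc[symmetric])
          qed
          then have "generate G (f ` {..<n}) \<subseteq> H" by (intro generate_subgroup_incl[OF _ H]) auto
          then show False using lab False HG by (auto simp: labellings_def)
        qed
        then obtain i where i: "i < n" "inv y \<otimes> f i \<notin> H" by auto
        have row: "row_prob n D f j \<le> c H" if j: "j < n" and yj: "inv y \<otimes> f j \<in> H" for j
        proof -
          let ?S = "\<Sum>h\<in>H. pmf (product_law ({..<n} - {j}) (\<lambda>k. D (j, k)) (\<lambda>k. f j \<otimes> inv f k)) h"
          have "?S \<le> 1 - e" by (rule sum_row_law_coset_le[OF bal f j i(1) H yG yj i(2)])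
          then have "?S / card H \<le> (1 - e) / card H" by (intro divide_right_mono) auto
          moreover have "\<bar>row_prob n D f j - ?S / card H\<bar> \<le> \<tau>"
            using near[OF f j y] yj by (simp add: H_def)
          moreover have "\<tau> \<le> (e / 2) / card H"
          proof -
            have "\<tau> \<le> (e / 2) / g" using \<tau> by simp
            also have "\<dots> \<le> (e / 2) / card H" using e two cH by (intro divide_left_mono) auto
            finally show ?thesis .
          qed
          moreover have "c H = (1 - e) / card H + (e / 2) / card H"
            unfolding c_def using cH by (simp add: field_simps)
          ultimately show ?thesis by linarith
        qed
        \<comment> \<open>Rows at exceptional vertices get only the trivial bound \<open>1\<close>,
          hence the second weight \<open>1\<close> in place of \<open>x\<close>.\<close>
        have "P f \<le> (\<Prod>j<n. coset_weight (c H) 1 H y (f j))"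
          unfolding P_def using row row_prob_nonneg row_prob_le_1
          by (intro prod_mono) (auto simp: coset_weight_def)
        also have "\<dots> = c H ^ (n - card ?s)" by (simp add: prod_coset_weight)
        finally show ?thesis using Bs by linarith
      qed
      have "0 \<le> (1 / g) ^ n" using g by simp
      then have "\<bar>P f - (1 / g) ^ n\<bar> \<le> B f" if "f \<in> labellings n"
        using 1 2[OF that] P_nonneg[of f] by linarith
      moreover have "\<bar>0 - (1 / g) ^ n\<bar> \<le> B f" using 1 \<open>0 \<le> (1 / g) ^ n\<close> by linarith
      ultimately have "\<bar>t f\<bar> \<le> B f" unfolding t_def by (simp only: split: if_split) blast
      moreover have "(1 / g) ^ n * ((1 + g * \<tau>) ^ n - 1) \<ge> 0"
        using g \<tau> by (intro mult_nonneg_nonneg) auto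
      ultimately show ?thesis by linarith
    qed
  qed
  have lab_sub: "labellings n \<subseteq> base" by (auto simp: labellings_def base_def)
  have "(\<Sum>f\<in>labellings n. P f) - 1 / g = (\<Sum>f\<in>base. t f)"
  proof -
    have "(\<Sum>f\<in>base. if f \<in> labellings n then P f else 0) = (\<Sum>f\<in>labellings n. P f)"
      using lab_sub fin_base by (intro sum.mono_neutral_cong_right) auto
    moreover have "(\<Sum>f\<in>base. (1 / g) ^ n) = 1 / g"
      using card_base g by (simp add: power_divide)
    ultimately show ?thesis by (simp add: t_def sum_subtractf)
  qed
  also have "\<bar>\<dots>\<bar> \<le> (\<Sum>f\<in>base. (1 / g) ^ n * ((1 + g * \<tau>) ^ n - 1) + B f)"
    by (intro order_trans[OF sum_abs] sum_mono t_le)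
  also have "\<dots> = (1 / g) * ((1 + g * \<tau>) ^ n - 1) + (\<Sum>f\<in>base. B f)"
    using card_base g by (simp add: sum.distrib power_divide)
  also have "\<dots> \<le> ((1 + g * \<tau>) ^ n - 1) + (\<Sum>f\<in>base. B f)"
  proof -
    have "0 \<le> (1 + g * \<tau>) ^ n - 1" using g \<tau> by simp
    then have "(1 / g) * ((1 + g * \<tau>) ^ n - 1) \<le> 1 * ((1 + g * \<tau>) ^ n - 1)"
      using g by (intro mult_right_mono) auto
    then show ?thesis by simp
  qed
  also have "(\<Sum>f\<in>base. B f) \<le> (\<Sum>f\<in>{..<n} \<rightarrow>\<^sub>E carrier G. B f)"
    using base_sub fin_PiE B_nonneg by (intro sum_mono2) auto
  also note sum_B
  finally show ?thesis by (simp add: P_def)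
qed

end

section \<open>Choice of the constants and the exponential rate\<close>

context finite_exponent_group
begin

text \<open>Handles the finitely many \<open>n\<close> below the threshold of the asymptotic
  estimate. For \<open>n > 0\<close> there are at most \<open>card (carrier G) ^ n\<close>
  labellings, each contributing at most \<open>1\<close>.\<close>

lemma expectation_card_Sur_bounded:
  "\<exists>U\<ge>0. \<forall>n<N. \<forall>D. \<bar>measure_pmf.expectation (random_digraph n D)
     (\<lambda>deg. real (card (Sur (sandpile n deg) G))) - 1 / real (card (carrier G))\<bar> \<le> U"
proof -
  have card_pos: "card (carrier G) > 0" using finite_carrier by (auto simp: card_gt_0_iff)
  then have g: "real (card (carrier G)) \<ge> 1" by simp
  \<comment> \<open>For \<open>n = 0\<close> there is no vertex \<open>0\<close> to normalise at.
    The random digraph is then a point mass at the default function \<open>0\<close>, so the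
    expectation is this one number.\<close>
  define E0 where "E0 = real (card (Sur (sandpile 0 (\<lambda>_. 0)) G))"
  define U where "U = real (card (carrier G)) ^ N + E0 + 1"
  have U: "E0 + 1 \<le> U" "real (card (carrier G)) ^ N + 1 \<le> U" using g by (auto simp: U_def E0_def)
  have near: "\<bar>v - 1 / real (card (carrier G))\<bar> \<le> U" if "0 \<le> v" "v + 1 \<le> U" for v
  proof -
    have "0 \<le> 1 / real (card (carrier G))" "1 / real (card (carrier G)) \<le> 1" using g by auto
    then show ?thesis using that by linarith
  qed
  have "\<bar>measure_pmf.expectation (random_digraph n D)
     (\<lambda>deg. real (card (Sur (sandpile n deg) G))) - 1 / real (card (carrier G))\<bar> \<le> U" if "n < N" for n D
  proof (cases "n = 0")
    case True
    have "offdiag 0 = {}" by (auto simp: offdiag_def)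
    then have "measure_pmf.expectation (random_digraph n D)
     (\<lambda>deg. real (card (Sur (sandpile n deg) G))) = E0"
      by (simp add: True random_digraph_def E0_def)
    then show ?thesis using near[of E0] U by (simp add: E0_def)
  next
    case False
    let ?S = "\<Sum>f\<in>labellings n. \<Prod>j<n. row_prob n D f j"
    have "?S \<le> (\<Sum>f\<in>labellings n. 1)"
      by (intro sum_mono prod_le_1) (auto simp: row_prob_nonneg row_prob_le_1)
    also have "\<dots> = real (card (labellings n))" by simp
    also have "\<dots> \<le> real (card ({..<n} \<rightarrow>\<^sub>E carrier G))"
      unfolding of_nat_le_iff
      by (rule card_mono) (auto simp: labellings_def intro!: finite_PiE finite_carrier)
    also have "\<dots> = real (card (carrier G)) ^ n" by (simp add: card_PiE)
    also have "\<dots> \<le> real (card (carrier G)) ^ N" using g that by (intro power_increasing) auto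
    finally have "?S + 1 \<le> U" using U by linarith
    moreover have "0 \<le> ?S" by (intro sum_nonneg prod_nonneg) (simp add: row_prob_nonneg)
    ultimately show ?thesis using near[of ?S] False by (simp add: expectation_card_Sur)
  qed
  moreover have "U \<ge> 0" using g by (simp add: U_def E0_def)
  ultimately show ?thesis by blast
qed

text \<open>Since \<tau> decays exponentially, \<open>(1 + g * \<tau>) ^ n - 1\<close> is of order
  \<open>n * g * \<tau>\<close>; half of the decay rate pays for the factor
  \<open>n\<close>.\<close>

lemma expectation_card_Sur_eventually:
  assumes eps: "eps > 0"
  shows "\<exists>r K N. 0 < r \<and> r < 1 \<and> K \<ge> 0 \<and> (\<forall>n D. N \<le> n \<longrightarrow> balanced_digraph eps n D \<longrightarrow>
    \<bar>measure_pmf.expectation (random_digraph n D) (\<lambda>deg. real (card (Sur (sandpile n deg) G)))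
       - 1 / real (card (carrier G))\<bar> \<le> K * r ^ n)"
proof -
  \<comment> \<open>Lowering \<open>eps\<close> weakens balancedness, so this is allowed; it keeps
    quantities such as \<open>1 - e / 2\<close> safely positive.\<close>
  define e where "e = min eps (1/2)"
  have e: "0 < e" "e \<le> 1/2" "e \<le> eps" using eps by (auto simp: e_def)
  define g where "g = real (card (carrier G))"
  have "card (carrier G) > 0" using finite_carrier by (auto simp: card_gt_0_iff)
  then have g: "g \<ge> 1" by (simp add: g_def)
  define x where "x = e / (4 * g)"
  define w where "w = 1 - e / 4"
  have w: "0 < w" "w < 1" using e by (auto simp: w_def)
  have "x \<le> e / 4" unfolding x_def using e g by (intro divide_left_mono) auto
  then have x: "0 < x" "x < w" using e g by (auto simp: x_def w_def)
  have ln_w: "ln w < 0" and ln_x: "ln x < ln w" using w x by (auto simp: ln_less_zero)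
  \<comment> \<open>chosen so that \<open>x powr (- \<alpha> n)\<close> uses up exactly half of the decay \<open>w ^ n\<close>\<close>
  define \<alpha> where "\<alpha> = ln w / (2 * ln x)"
  have \<alpha>: "0 < \<alpha>" "\<alpha> < 1" using ln_w ln_x by (auto simp: \<alpha>_def field_simps)
  have "ln x \<noteq> 0" using ln_w ln_x by linarith
  then have "\<alpha> * ln x = ln (sqrt w)" using w by (simp add: \<alpha>_def ln_sqrt)
  then have \<alpha>3: "x powr \<alpha> = sqrt (1 - e / 4)" using x w by (simp add: powr_def w_def[symmetric])
  define \<delta> where "\<delta> = \<alpha> / g"
  have \<delta>: "\<delta> > 0" using \<alpha> g by (simp add: \<delta>_def)
  obtain \<rho> M where *: "0 < \<rho> \<and> \<rho> < 1 \<and> M > 0 \<and> (\<forall>\<delta> n D f y j. balanced_digraph e n D \<longrightarrow>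
    f \<in> {..<n} \<rightarrow> carrier G \<longrightarrow> j < n \<longrightarrow> y \<in> frequent \<delta> n f \<longrightarrow> inv y \<otimes> f j \<in> frequent_subgroup \<delta> n f \<longrightarrow>
     \<bar>row_prob n D f j - (\<Sum>h\<in>frequent_subgroup \<delta> n f.
         pmf (product_law ({..<n} - {j}) (\<lambda>k. D (j, k)) (\<lambda>k. f j \<otimes> inv f k)) h) / card (frequent_subgroup \<delta> n f)\<bar>
       \<le> M * \<rho> ^ (nat \<lfloor>\<delta> * real n\<rfloor> - 1))"
    using row_prob_near_average[OF e(1)] by (elim exE)
  then have \<rho>: "0 < \<rho>" "\<rho> < 1" and M: "M > 0" by blast+
  note near = *[THEN conjunct2, THEN conjunct2, THEN conjunct2, rule_format]
  define \<tau> where "\<tau> n = M * \<rho> ^ (nat \<lfloor>\<delta> * real n\<rfloor> - 1)" for n :: nat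
  define \<theta> where "\<theta> = \<rho> powr \<delta>"
  have \<theta>: "0 < \<theta>" "\<theta> < 1" using \<rho> \<delta> powr_less_mono'[of \<rho> 0 \<delta>] by (auto simp: \<theta>_def)
  \<comment> \<open>The two powers of \<rho> compensate for the floor and for the vertex removed
    from its own row.\<close>
  define M' where "M' = M / \<rho> ^ 2"
  have M': "M' > 0" using M \<rho> by (simp add: M'_def)
  have \<tau>0: "0 \<le> \<tau> n" for n using M \<rho> by (simp add: \<tau>_def)
  have \<tau>_le: "\<tau> n \<le> M' * \<theta> ^ n" for n
  proof -
    have "\<delta> * real n - 2 \<le> real (nat \<lfloor>\<delta> * real n\<rfloor> - 1)" by linarith
    then have "\<rho> powr real (nat \<lfloor>\<delta> * real n\<rfloor> - 1) \<le> \<rho> powr (\<delta> * real n - 2)"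
      using \<rho> by (intro powr_mono') auto
    also have "\<dots> = \<theta> ^ n / \<rho> ^ 2"
    proof -
      have "\<rho> powr (\<delta> * real n) = \<theta> powr real n" by (simp add: \<theta>_def powr_powr)
      also have "\<dots> = \<theta> ^ n" by (rule powr_realpow[OF \<theta>(1)])
      finally show ?thesis using \<rho> by (simp add: powr_diff)
    qed
    finally have "\<rho> ^ (nat \<lfloor>\<delta> * real n\<rfloor> - 1) \<le> \<theta> ^ n / \<rho> ^ 2"
      using \<rho> by (simp add: powr_realpow)
    then have "M * \<rho> ^ (nat \<lfloor>\<delta> * real n\<rfloor> - 1) \<le> M * (\<theta> ^ n / \<rho> ^ 2)" using M by (intro mult_left_mono) auto
    then show ?thesis by (simp add: \<tau>_def M'_def)
  qed
  define \<sigma> where "\<sigma> = sqrt \<theta>"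
  have \<sigma>: "0 < \<sigma>" "\<sigma> < 1" using \<theta> by (auto simp: \<sigma>_def)
  have \<theta>\<sigma>: "\<theta> ^ n = \<sigma> ^ n * \<sigma> ^ n" for n using \<theta> by (simp add: \<sigma>_def power_mult_distrib[symmetric])
  have "(\<lambda>n. real n * \<sigma> ^ n) \<longlonglongrightarrow> 0" using \<sigma> by (intro powser_times_n_limit_0) auto
  then have "Bseq (\<lambda>n. real n * \<sigma> ^ n)" by (intro convergent_imp_Bseq convergentI)
  then obtain b where b: "b > 0" "\<And>n. norm (real n * \<sigma> ^ n) \<le> b" unfolding Bseq_def by blast
  \<comment> \<open>\<open>b + 1\<close> bounds \<open>(n + 1) * \<sigma> ^ n\<close>. The factor
    \<open>n + 1\<close> controls two quantities together: \<open>n * g * \<tau>\<close> for the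
    product error and \<open>g * \<tau>\<close> for the smallness required of \<tau>.\<close>
  define Q where "Q = g * M' * (b + 1)"
  have Q: "Q > 0" using g M' b by (simp add: Q_def)
  have bound: "(real n + 1) * (g * \<tau> n) \<le> Q * \<sigma> ^ n" for n
  proof -
    have "\<sigma> ^ n \<le> 1" using \<sigma> by (simp add: power_le_one)
    then have nb: "(real n + 1) * \<sigma> ^ n \<le> b + 1" using b(2)[of n] \<sigma> by (simp add: distrib_right)
    have "(real n + 1) * (g * \<tau> n) \<le> (real n + 1) * (g * (M' * (\<sigma> ^ n * \<sigma> ^ n)))"
      using \<tau>_le[of n] g by (intro mult_left_mono) (auto simp: \<theta>\<sigma>)
    also have "\<dots> = (g * M' * \<sigma> ^ n) * ((real n + 1) * \<sigma> ^ n)" by (simp add: mult_ac)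
    also have "\<dots> \<le> (g * M' * \<sigma> ^ n) * (b + 1)"
      using nb g M' \<sigma> by (intro mult_left_mono) auto
    finally show ?thesis by (simp add: Q_def mult_ac)
  qed
  have "(\<lambda>n. Q * \<sigma> ^ n) \<longlonglongrightarrow> Q * 0" using \<sigma> by (intro tendsto_mult tendsto_const LIMSEQ_power_zero) auto
  then have "\<forall>\<^sub>F n in sequentially. Q * \<sigma> ^ n < e / 2" using e by (intro order_tendstoD) auto
  then obtain N0 where N0: "\<And>n. n \<ge> N0 \<Longrightarrow> Q * \<sigma> ^ n < e / 2" unfolding eventually_sequentially by blast
  define r where "r = max \<sigma> (sqrt w)"
  have r: "0 < r" "r < 1" using \<sigma> w by (auto simp: r_def)
  define K where "K = 2 * Q + 2 ^ card (carrier G) * g"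
  have K: "K \<ge> 0" using Q g by (simp add: K_def)
  have "\<bar>measure_pmf.expectation (random_digraph n D) (\<lambda>deg. real (card (Sur (sandpile n deg) G)))
       - 1 / real (card (carrier G))\<bar> \<le> K * r ^ n"
    if n: "max N0 1 \<le> n" and bal': "balanced_digraph eps n D" for n D
  proof -
    have n0: "n > 0" and nN: "n \<ge> N0" using n by auto
    have bal: "balanced_digraph e n D"
      using bal' e(3) balanced_rv_mono by (auto simp: balanced_digraph_def)
    have g\<tau>: "0 \<le> g * \<tau> n" using g \<tau>0[of n] by simp
    have ng\<tau>: "real n * (g * \<tau> n) + g * \<tau> n \<le> Q * \<sigma> ^ n" using bound[of n] by (simp add: distrib_right)
    have n_ge: "0 \<le> real n * (g * \<tau> n)" using g\<tau> by simp
    have "g * \<tau> n \<le> e / 2" using ng\<tau> n_ge N0[OF nN] by linarith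
    then have \<tau>e: "\<tau> n \<le> e / (2 * g)" using g by (simp add: field_simps)
    have err: "\<bar>(\<Sum>f\<in>labellings n. \<Prod>j<n. row_prob n D f j) - 1 / g\<bar>
     \<le> ((1 + g * \<tau> n) ^ n - 1) + 2 ^ card (carrier G) * g * sqrt (1 - e / 4) ^ n"
      unfolding g_def
      by (rule expectation_error_bound[OF n0 e(1,2) _ \<alpha> \<alpha>3 bal _ \<tau>0])
        (use near[OF bal, where \<delta> = \<delta>] \<tau>e in \<open>auto simp: x_def g_def \<delta>_def \<tau>_def\<close>)
    have "(1 + g * \<tau> n) ^ n \<le> exp (g * \<tau> n) ^ n"
      using g\<tau> exp_ge_add_one_self[of "g * \<tau> n"] by (intro power_mono) auto
    also have "\<dots> = exp (real n * (g * \<tau> n))" by (simp add: exp_of_nat_mult)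
    also have "\<dots> \<le> 1 + real n * (g * \<tau> n) + (real n * (g * \<tau> n))\<^sup>2"
      using n_ge ng\<tau> g\<tau> N0[OF nN] e by (intro exp_bound) auto
    also have "(real n * (g * \<tau> n))\<^sup>2 \<le> real n * (g * \<tau> n)"
    proof -
      have "real n * (g * \<tau> n) \<le> 1" using ng\<tau> g\<tau> N0[OF nN] e by linarith
      then show ?thesis unfolding power2_eq_square using n_ge by (rule mult_left_le)
    qed
    finally have "(1 + g * \<tau> n) ^ n - 1 \<le> 2 * (Q * \<sigma> ^ n)" using ng\<tau> g\<tau> by linarith
    also have "\<dots> \<le> 2 * (Q * r ^ n)"
      using Q \<sigma> by (intro mult_left_mono power_mono) (auto simp: r_def)
    finally have 1: "(1 + g * \<tau> n) ^ n - 1 \<le> 2 * (Q * r ^ n)" .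
    have "sqrt (1 - e / 4) ^ n \<le> r ^ n" using w by (intro power_mono) (auto simp: r_def w_def)
    then have "2 ^ card (carrier G) * g * sqrt (1 - e / 4) ^ n \<le> 2 ^ card (carrier G) * g * r ^ n"
      using g by (intro mult_left_mono) auto
    moreover have "K * r ^ n = 2 * (Q * r ^ n) + 2 ^ card (carrier G) * g * r ^ n"
      by (simp add: K_def distrib_right)
    ultimately have "\<bar>(\<Sum>f\<in>labellings n. \<Prod>j<n. row_prob n D f j) - 1 / g\<bar> \<le> K * r ^ n"
      using err 1 by linarith
    then show ?thesis by (simp add: expectation_card_Sur[OF n0] g_def)
  qed
  then show ?thesis using r K by blast
qed

end

theorem mainTheorem7:
  fixes eps :: real and a :: nat and G :: "('g, 'm) monoid_scheme"
  assumes "eps > 0" and "a > 0"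
    and "comm_group G" and "finite (carrier G)"
    and "\<forall>x\<in>carrier G. x [^]\<^bsub>G\<^esub> a = \<one>\<^bsub>G\<^esub>"
  shows "\<exists>K c. K > 0 \<and> c > 0 \<and>
    (\<forall>n D. balanced_digraph eps n D \<longrightarrow>
       \<bar>measure_pmf.expectation (random_digraph n D)
            (\<lambda>deg. real (card (Sur (sandpile n deg) G))) - 1 / real (card (carrier G))\<bar>
         \<le> K * exp (- c * real n))"
proof -
  interpret finite_exponent_group G a
    using assms by (simp add: finite_exponent_group_def finite_exponent_group_axioms_def)
  let ?err = "\<lambda>n D. \<bar>measure_pmf.expectation (random_digraph n D)
            (\<lambda>deg. real (card (Sur (sandpile n deg) G))) - 1 / real (card (carrier G))\<bar>"
  obtain r K N where r: "0 < r" "r < 1" and K: "K \<ge> 0"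
    and large: "\<And>n D. N \<le> n \<Longrightarrow> balanced_digraph eps n D \<Longrightarrow> ?err n D \<le> K * r ^ n"
    using expectation_card_Sur_eventually[OF assms(1)] by blast
  obtain U where U: "U \<ge> 0" and small: "\<And>n D. n < N \<Longrightarrow> ?err n D \<le> U"
    using expectation_card_Sur_bounded[of N] by blast
  \<comment> \<open>For \<open>n < N\<close> the power \<open>r ^ n\<close> is at least
    \<open>r ^ N\<close>, so \<open>U / r ^ N\<close> covers the bounded range; the final
    \<open>1\<close> makes the constant strictly positive.\<close>
  define K' where "K' = K + U / r ^ N + 1"
  have "U / r ^ N \<ge> 0" using U r by simp
  then have K': "K' > 0" "K \<le> K'" "U / r ^ N \<le> K'" using K by (auto simp: K'_def)
  have exp_r: "exp (- (- ln r) * real n) = r ^ n" for n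
    using r by (simp add: powr_realpow[symmetric] powr_def mult.commute)
  have "?err n D \<le> K' * r ^ n" if "balanced_digraph eps n D" for n D
  proof (cases "N \<le> n")
    case True
    then have "?err n D \<le> K * r ^ n" using large that by blast
    also have "\<dots> \<le> K' * r ^ n" using K' r by (intro mult_right_mono) auto
    finally show ?thesis .
  next
    case False
    then have "?err n D \<le> U" by (intro small) auto
    also have "\<dots> = U / r ^ N * r ^ N" using r by simp
    also have "\<dots> \<le> K' * r ^ n"
      using K' r False by (intro mult_mono power_decreasing) auto
    finally show ?thesis .
  qed
  then show ?thesis
    using K' r by (intro exI[of _ K'] exI[of _ "- ln r"]) (auto simp only: exp_r, simp_all add: ln_less_zero)
qed

end
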